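(* Let $E$ be a self-affine Moran set with Moran construction $\{(n_k,m_k,\mathcal{D}_k)\}_{k\ge1}$, and suppose $N^+=\sup\{n_k,m_k : k\ge 1\}<\infty$. Let $\mathbf{p}\in\mathcal{P}$ and let $\mu_{\mathbf{p}}$ be the associated self-affine Moran measure. Suppose that either $E$ satisfies the frequency separation condition (FSC) or $\mu_{\mathbf{p}}$ satisfies the measure separation condition (MSC). Then $$\dim_{\rm H}\mu_{\mathbf{p}}=\liminf_{k\to\infty}\frac{H_k(\mathbf{p})}{\sum_{i=1}^k\log m_i},\qquad \dim_{\rm P}\mu_{\mathbf{p}}=\limsup_{k\to\infty}\frac{H_k(\mathbf{p})}{\sum_{i=1}^k\log m_i},$$ where $H_k(\mathbf{p})$ is the $k$th entropy.
   Context: Self-affine Moran set: for each integer $k\ge1$ let $n_k\ge2$, $m_k\ge2$ be integers and $\mathcal{D}_k\subset\{0,\dots,n_k-1\}\times\{0,\dots,m_k-1\}$ with $r_k=\operatorname{card}(\mathcal{D}_k)\ge2$. Put $T_k=\operatorname{diag}(n_k^{-1},m_k^{-1})$ and, for $w\in\mathcal{D}_k$, $\Phi_w(x)=T_k(x+w)$ on $\mathbb{R}^2$ (the level $k$ being understood). Let $\Sigma^k=\prod_{j=1}^k\mathcal{D}_j$, $\Sigma^\infty=\prod_{j=1}^\infty\mathcal{D}_j$. For $\mathbf{w}=w_1\cdots w_k\in\Sigma^k$ put $J_{\mathbf{w}}=\Phi_{w_1}\circ\cdots\circ\Phi_{w_k}([0,1]^2)$. The self-affine Moran set is $E=\bigcap_{k\ge1}\bigcup_{\mathbf{w}\in\Sigma^k}J_{\mathbf{w}}$.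 Equivalently $E=\Pi(\Sigma^\infty)$ with $\Pi(\mathbf{w})=\sum_{k\ge1}\operatorname{diag}\big(\prod_{h=1}^k n_h^{-1},\prod_{h=1}^k m_h^{-1}\big)w_k$. Measures: $\mathcal{P}=\prod_{k\ge1}\mathcal{P}_k$, where $\mathcal{P}_k$ is the set of probability vectors on $\mathcal{D}_k$. For $\mathbf{p}=(\mathbf{p}_k)_k\in\mathcal{P}$, $\mathbf{p}_k=(p_k(w))_{w\in\mathcal{D}_k}$, let $\nu_{\mathbf{p}}$ be the Borel probability (product) measure on $\Sigma^\infty$ giving the cylinder $[w_1\cdots w_k]$ (the set of all $\tau\in\Sigma^\infty$ beginning with $w_1\cdots w_k$) mass $p_1(w_1)\cdots p_k(w_k)$. The self-affine Moran measure is $\mu_{\mathbf{p}}(A)=\nu_{\mathbf{p}}(\Pi^{-1}A)$. For $0\le j\le m_k-1$ put $q_k(j)=\sum_{i':(i',j)\in\mathcal{D}_k}p_k(i',j)$ and for $0\le i\le n_k-1$ put $\widehat{q}_k(i)=\sum_{j':(i,j')\in\mathcal{D}_k}p_k(i,j')$ (empty sums are $0$); for $w=(i,j)\in\mathcal{D}_k$ write $q_k(w)=q_k(j)$, $\widehat{q}_k(w)=\widehat{q}_k(i)$. For each $k\ge1$ let $l=l(k)$ be the unique integer with $\frac1{n_1\cdots n_l}\le\frac1{m_1\cdots m_k}<\frac1{n_1\cdots n_{l-1}}$. The $k$th entropy is (with $0\log0=0$) $$H_k(\mathbf{p})=\begin{cases}-\sum_{i=1}^{l}\sum_{w\in\mathcal{D}_i}p_i(w)\log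 p_i(w)-\sum_{i=l+1}^{k}\sum_{w\in\mathcal{D}_i}p_i(w)\log q_i(w), & l\le k,\\ -\sum_{i=1}^{k}\sum_{w\in\mathcal{D}_i}p_i(w)\log p_i(w)-\sum_{i=k+1}^{l}\sum_{w\in\mathcal{D}_i}p_i(w)\log\widehat{q}_i(w), & l>k.\end{cases}$$ Separation conditions: $\mathcal{D}_k$ is centred if $i\notin\{0,n_k-1\}$ and $j\notin\{0,m_k-1\}$ for every $(i,j)\in\mathcal{D}_k$. $E$ satisfies FSC if there is $c>0$ with $\lim_{n\to\infty}\frac1n\operatorname{card}\{1\le k\le n:\mathcal{D}_k\text{ is centred}\}=c$. $\mu_{\mathbf{p}}$ satisfies MSC if there is a constant $0<C<1$ such that $\max\{q_k(0),q_k(m_k-1),\widehat{q}_k(0),\widehat{q}_k(n_k-1)\}<C$ for every $k\ge1$. Dimensions of a finite Borel measure $\mu$: $\dim_{\rm H}\mu=\inf\{\dim_{\rm H}A:\mu(A^c)=0\}$ and $\dim_{\rm P}\mu=\inf\{\dim_{\rm P}A:\mu(A^c)=0\}$, where $\dim_{\rm H}A$, $\dim_{\rm P}A$ are the Hausdorff and packing dimensions of the set $A$. *)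

theory Defs
  imports "HOL-Probability.Probability"
begin

section \<open>Hausdorff and packing dimension\<close>

(* The convention for s = 0 is that every nonempty set has weight 1; it is spelled out because
   0 powr 0 = 0 in HOL. *)
definition diam_pow :: "real \<Rightarrow> 'a::metric_space set \<Rightarrow> ennreal" where
  "diam_pow s U =
     (if U = {} then 0 else if s = 0 then 1 else ennreal (diameter U powr s))"

(* Boundedness is required separately because diameter is unspecified on unbounded sets. *)
definition hausdorff_premeasure :: "real \<Rightarrow> real \<Rightarrow> 'a::metric_space set \<Rightarrow> ennreal" where
  "hausdorff_premeasure s \<delta> A =
     Inf {(\<Sum>i. diam_pow s (U i)) | U :: nat \<Rightarrow> 'a set.
            A \<subseteq> (\<Union>i. U i) \<and> (\<forall>i. bounded (U i) \<and> diameter (U i) \<le> \<delta>)}"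

definition hausdorff_measure :: "real \<Rightarrow> 'a::metric_space set \<Rightarrow> ennreal" where
  "hausdorff_measure s A = (SUP \<delta>\<in>{0<..}. hausdorff_premeasure s \<delta> A)"

definition hausdorff_dim :: "'a::metric_space set \<Rightarrow> ereal" where
  "hausdorff_dim A = Inf {ereal s | s. 0 \<le> s \<and> hausdorff_measure s A = 0}"

(* A packing is a set of pairs (centre, radius) whose closed balls are pairwise disjoint. *)
definition packings :: "real \<Rightarrow> 'a::metric_space set \<Rightarrow> ('a \<times> real) set set" where
  "packings \<delta> A =
     {B. countable B \<and> B \<subseteq> A \<times> {0<..\<delta>} \<and> disjoint_family_on (\<lambda>(x, r). cball x r) B}"

definition packing_premeasure :: "real \<Rightarrow> 'a::metric_space set \<Rightarrow> ennreal" where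
  "packing_premeasure s A =
     (INF \<delta>\<in>{0<..}. SUP B\<in>packings \<delta> A. \<Sum>\<^sub>\<infinity>(x, r)\<in>B. ennreal ((2 * r) powr s))"

definition packing_measure :: "real \<Rightarrow> 'a::metric_space set \<Rightarrow> ennreal" where
  "packing_measure s A =
     Inf {(\<Sum>i. packing_premeasure s (F i)) | F :: nat \<Rightarrow> 'a set. A \<subseteq> (\<Union>i. F i)}"

definition packing_dim :: "'a::metric_space set \<Rightarrow> ereal" where
  "packing_dim A = Inf {ereal s | s. 0 \<le> s \<and> packing_measure s A = 0}"

(* The sets A are restricted to measurable ones because emeasure is 0 on all other sets. *)
definition hausdorff_dim_measure :: "'a::metric_space measure \<Rightarrow> ereal" where
  "hausdorff_dim_measure M =
     Inf {hausdorff_dim A | A. A \<in> sets M \<and> emeasure M (space M - A) = 0}"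

definition packing_dim_measure :: "'a::metric_space measure \<Rightarrow> ereal" where
  "packing_dim_measure M =
     Inf {packing_dim A | A. A \<in> sets M \<and> emeasure M (space M - A) = 0}"


section \<open>Self-affine Moran sets\<close>

(* All sequences are indexed by k \<ge> 1; their values at 0 are never used. *)

definition moran_construction ::
    "(nat \<Rightarrow> nat) \<Rightarrow> (nat \<Rightarrow> nat) \<Rightarrow> (nat \<Rightarrow> (nat \<times> nat) set) \<Rightarrow> bool" where
  "moran_construction n m D \<longleftrightarrow>
     (\<forall>k\<ge>1. 2 \<le> n k \<and> 2 \<le> m k \<and> D k \<subseteq> {0..<n k} \<times> {0..<m k} \<and> 2 \<le> card (D k))"

definition digit_map ::
    "(nat \<Rightarrow> nat) \<Rightarrow> (nat \<Rightarrow> nat) \<Rightarrow> nat \<Rightarrow> nat \<times> nat \<Rightarrow> real \<times> real \<Rightarrow> real \<times> real" where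
  "digit_map n m k w x =
     ((fst x + real (fst w)) / real (n k), (snd x + real (snd w)) / real (m k))"

primrec word_map ::
    "(nat \<Rightarrow> nat) \<Rightarrow> (nat \<Rightarrow> nat) \<Rightarrow> (nat \<Rightarrow> nat \<times> nat) \<Rightarrow> nat \<Rightarrow> real \<times> real \<Rightarrow> real \<times> real" where
  "word_map n m w 0 = id"
| "word_map n m w (Suc k) = word_map n m w k \<circ> digit_map n m (Suc k) (w (Suc k))"

definition moran_set ::
    "(nat \<Rightarrow> nat) \<Rightarrow> (nat \<Rightarrow> nat) \<Rightarrow> (nat \<Rightarrow> (nat \<times> nat) set) \<Rightarrow> (real \<times> real) set" where
  "moran_set n m D =
     (\<Inter>k\<in>{1..}. \<Union>w\<in>(\<Pi>\<^sub>E j\<in>{1..k}. D j). word_map n m w k ` ({0..1} \<times> {0..1}))"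

definition coding_map ::
    "(nat \<Rightarrow> nat) \<Rightarrow> (nat \<Rightarrow> nat) \<Rightarrow> (nat \<Rightarrow> nat \<times> nat) \<Rightarrow> real \<times> real" where
  "coding_map n m w =
     (\<Sum>k. (real (fst (w (Suc k))) / (\<Prod>h=1..Suc k. real (n h)),
           real (snd (w (Suc k))) / (\<Prod>h=1..Suc k. real (m h))))"


section \<open>Self-affine Moran measures\<close>

definition prob_vector_on :: "'a set \<Rightarrow> ('a \<Rightarrow> real) \<Rightarrow> bool" where
  "prob_vector_on A v \<longleftrightarrow> (\<forall>w\<in>A. 0 \<le> v w) \<and> (\<Sum>w\<in>A. v w) = 1"

definition moran_prob_vectors ::
    "(nat \<Rightarrow> (nat \<times> nat) set) \<Rightarrow> (nat \<Rightarrow> nat \<times> nat \<Rightarrow> real) set" where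
  "moran_prob_vectors D = {p. \<forall>k\<ge>1. prob_vector_on (D k) (p k)}"

(* The underlying space is the symbolic space of all infinite words, represented as
   extensional functions on {1..}; the product sigma-algebra of the finite discrete factors
   is its Borel sigma-algebra. *)
definition symbolic_measure ::
    "(nat \<Rightarrow> (nat \<times> nat) set) \<Rightarrow> (nat \<Rightarrow> nat \<times> nat \<Rightarrow> real) \<Rightarrow> (nat \<Rightarrow> nat \<times> nat) measure" where
  "symbolic_measure D p = (\<Pi>\<^sub>M k\<in>{1..}. point_measure (D k) (\<lambda>w. ennreal (p k w)))"

definition moran_measure ::
    "(nat \<Rightarrow> nat) \<Rightarrow> (nat \<Rightarrow> nat) \<Rightarrow> (nat \<Rightarrow> (nat \<times> nat) set) \<Rightarrow> (nat \<Rightarrow> nat \<times> nat \<Rightarrow> real)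
       \<Rightarrow> (real \<times> real) measure" where
  "moran_measure n m D p = distr (symbolic_measure D p) borel (coding_map n m)"

definition row_prob ::
    "(nat \<Rightarrow> (nat \<times> nat) set) \<Rightarrow> (nat \<Rightarrow> nat \<times> nat \<Rightarrow> real) \<Rightarrow> nat \<Rightarrow> nat \<Rightarrow> real" where
  "row_prob D p k j = (\<Sum>i\<in>{i. (i, j) \<in> D k}. p k (i, j))"

definition col_prob ::
    "(nat \<Rightarrow> (nat \<times> nat) set) \<Rightarrow> (nat \<Rightarrow> nat \<times> nat \<Rightarrow> real) \<Rightarrow> nat \<Rightarrow> nat \<Rightarrow> real" where
  "col_prob D p k i = (\<Sum>j\<in>{j. (i, j) \<in> D k}. p k (i, j))"


section \<open>Entropies\<close>

definition approx_level :: "(nat \<Rightarrow> nat) \<Rightarrow> (nat \<Rightarrow> nat) \<Rightarrow> nat \<Rightarrow> nat" where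
  "approx_level n m k =
     (THE l. 1 \<le> l \<and> 1 / (\<Prod>i=1..l. real (n i)) \<le> 1 / (\<Prod>i=1..k. real (m i))
                 \<and> 1 / (\<Prod>i=1..k. real (m i)) < 1 / (\<Prod>i=1..l - 1. real (n i)))"

(* ln 0 = 0 in HOL, which agrees with the convention 0 log 0 = 0. *)
definition moran_entropy ::
    "(nat \<Rightarrow> nat) \<Rightarrow> (nat \<Rightarrow> nat) \<Rightarrow> (nat \<Rightarrow> (nat \<times> nat) set) \<Rightarrow> (nat \<Rightarrow> nat \<times> nat \<Rightarrow> real)
       \<Rightarrow> nat \<Rightarrow> real" where
  "moran_entropy n m D p k =
     (let l = approx_level n m k in
      if l \<le> k then
        - (\<Sum>i=1..l. \<Sum>w\<in>D i. p i w * ln (p i w))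
        - (\<Sum>i=l+1..k. \<Sum>w\<in>D i. p i w * ln (row_prob D p i (snd w)))
      else
        - (\<Sum>i=1..k. \<Sum>w\<in>D i. p i w * ln (p i w))
        - (\<Sum>i=k+1..l. \<Sum>w\<in>D i. p i w * ln (col_prob D p i (fst w))))"


section \<open>Separation conditions\<close>

definition centred ::
    "(nat \<Rightarrow> nat) \<Rightarrow> (nat \<Rightarrow> nat) \<Rightarrow> (nat \<Rightarrow> (nat \<times> nat) set) \<Rightarrow> nat \<Rightarrow> bool" where
  "centred n m D k \<longleftrightarrow> (\<forall>(i, j)\<in>D k. i \<notin> {0, n k - 1} \<and> j \<notin> {0, m k - 1})"

definition frequency_separation ::
    "(nat \<Rightarrow> nat) \<Rightarrow> (nat \<Rightarrow> nat) \<Rightarrow> (nat \<Rightarrow> (nat \<times> nat) set) \<Rightarrow> bool" where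
  "frequency_separation n m D \<longleftrightarrow>
     (\<exists>c>0. (\<lambda>N. real (card {k \<in> {1..N}. centred n m D k}) / real N) \<longlonglongrightarrow> c)"

definition measure_separation ::
    "(nat \<Rightarrow> nat) \<Rightarrow> (nat \<Rightarrow> nat) \<Rightarrow> (nat \<Rightarrow> (nat \<times> nat) set) \<Rightarrow> (nat \<Rightarrow> nat \<times> nat \<Rightarrow> real)
       \<Rightarrow> bool" where
  "measure_separation n m D p \<longleftrightarrow>
     (\<exists>C. 0 < C \<and> C < 1 \<and>
        (\<forall>k\<ge>1. Max {row_prob D p k 0, row_prob D p k (m k - 1),
                     col_prob D p k 0, col_prob D p k (n k - 1)} < C))"

end

theory Submission
  imports Defs "HOL-Real_Asymp.Real_Asymp"
begin

text \<open>
  Fix \<open>k\<close> and call two words equivalent if their first coordinates agree up to level \<open>l(k)\<close> and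
  their second coordinates agree up to level \<open>k\<close>. The classes are the approximate squares of side
  \<open>1 / (m\<^sub>1 \<cdots> m\<^sub>k)\<close>; the logarithm of the mass of the class of a random word is minus a sum of
  independent terms with mean \<open>H\<^sub>k\<close>, so by a Chernoff bound and Borel--Cantelli the mass is almost surely
  \<open>exp (- H\<^sub>k + o(k))\<close>.

  The upper bounds hold without separation: there are at most \<open>1 / \<theta>\<close> classes of mass at least \<open>\<theta>\<close>, which
  bounds both the covers of the points lying in infinitely many heavy squares and the packings of the
  points lying in all late heavy squares. For the lower bounds, either separation condition forces, almost
  surely and for all large \<open>k\<close>, a digit away from each of the two boundary values within \<open>\<epsilon> k\<close> levels after
  \<open>l(k)\<close>, respectively \<open>k\<close>. Hence a ball of radius \<open>(m\<^sub>1 \<cdots> m\<^sub>k) powr (- 1 - \<delta>)\<close> around a typical point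
  meets the image of its own class only, so masses of small balls are controlled by masses of classes.
\<close>

section \<open>Dimensions of coded measures\<close>

text \<open>The vectors \<open>p k\<close> have no positive lower bound, so the information of a
  single digit is unbounded and inequalities for bounded summands do not apply. What survives is a
  uniform exponential moment: a digit weighs its own \<open>exp\<close> of information by at most 1,
  and a level has at most \<open>K * K\<close> digits. The bound \<open>K\<close> on the bases
  enters also because the number of levels seen by an approximate square is linear in
  \<open>k\<close>, because consecutive scales are comparable, and because a window of
  \<open>t\<close> levels shrinks an interval by at most \<open>K ^ t\<close>.

  Neighbouring squares may touch, so a ball as large as the square can meet several classes even
  around a typical point. Passing to the exponent \<open>1 + d\<close> pays for the window in which
  the expansion moves off the boundary. Scales grow at least like \<open>2 ^ k\<close>, so errors
  linear in \<open>k\<close> with a small coefficient become small powers of the scale and vanish in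
  the dimension.

  Under FSC the window comes from the existence of the limit: the counting function of centred
  levels is linear up to \<open>o(k)\<close> and cannot stay constant over a stretch proportional to
  \<open>k\<close>.\<close>

lemma geometric_tail_sums:
  fixes q C :: real
  assumes "0 < q" "q < 1"
  shows "(\<lambda>k. if j \<le> k then C * q ^ k else 0) sums (C * q ^ j / (1 - q))"
proof -
  have "(\<lambda>i. C * q ^ j * q ^ i) sums (C * q ^ j * (1 / (1 - q)))"
    using assms by (intro sums_mult geometric_sums) simp
  then have "(\<lambda>i. if j \<le> i + j then C * q ^ (i + j) else 0) sums (C * q ^ j / (1 - q))"
    by (simp add: power_add algebra_simps)
  then show ?thesis
    using sums_zero_iff_shift[of j "\<lambda>k. if j \<le> k then C * q ^ k else 0" "C * q ^ j / (1 - q)"] by simp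
qed

text \<open>The dimension formulas need only this, freed from digits: \<open>M k\<close> is the
  reciprocal of the scale, \<open>key k\<close> the class of a word at that scale, and
  \<open>H k\<close> plays the entropy. The lower half of \<open>entropy\<close> serves the upper
  bounds on dimension; its upper half and \<open>separation\<close> serve the lower bounds.
  \<open>M\<close> need not be monotone, which shapes several choices of levels below.\<close>

locale coded_measure = prob_space \<nu> for \<nu> :: "'w measure" +
  fixes \<pi> :: "'w \<Rightarrow> 'a::metric_space" and key :: "nat \<Rightarrow> 'w \<Rightarrow> 'k"
    and M H :: "nat \<Rightarrow> real" and c N :: real
  assumes measurable_coding: "\<pi> \<in> borel_measurable \<nu>"
    and finite_keys: "finite (key k ` space \<nu>)"
    and sets_fibre: "{w \<in> space \<nu>. key k w = x} \<in> events"
    and M_ge: "2 ^ k \<le> M k"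
    and M_Suc: "M (Suc k) \<le> N * M k"
    and H_nonneg: "0 \<le> H k"
    and c_pos: "0 < c"
    and dist_fibre: "\<lbrakk>v \<in> space \<nu>; w \<in> space \<nu>; key k v = key k w\<rbrakk> \<Longrightarrow> dist (\<pi> v) (\<pi> w) \<le> c / M k"
    and entropy: "0 < e \<Longrightarrow> AE w in \<nu>. \<forall>\<^sub>F k in sequentially.
        M k powr (- e) * exp (- H k) \<le> prob {v \<in> space \<nu>. key k v = key k w} \<and>
        prob {v \<in> space \<nu>. key k v = key k w} \<le> M k powr e * exp (- H k)"
    and separation: "0 < d \<Longrightarrow> AE w in \<nu>. \<forall>\<^sub>F k in sequentially.
        \<forall>v\<in>space \<nu>. dist (\<pi> w) (\<pi> v) < M k powr (- (1 + d)) \<longrightarrow> key k v = key k w"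
begin

abbreviation fibre :: "nat \<Rightarrow> 'k \<Rightarrow> 'w set" where
  "fibre k x \<equiv> {w \<in> space \<nu>. key k w = x}"

abbreviation ratio :: "nat \<Rightarrow> ereal" where
  "ratio k \<equiv> ereal (H k / ln (M k))"

definition heavy_keys :: "nat \<Rightarrow> real \<Rightarrow> 'k set" where
  "heavy_keys k t = {x \<in> key k ` space \<nu>. M k powr (- t) \<le> prob (fibre k x)}"

text \<open>A closed ball about an arbitrary representative stands in for the image of the fibre. It
  contains that image by \<open>dist_fibre\<close>, and finite unions of such balls are closed, so
  the carriers built from them are Borel.\<close>

definition key_ball :: "nat \<Rightarrow> 'k \<Rightarrow> 'a set" where
  "key_ball k x = cball (\<pi> (inv_into (space \<nu>) (key k) x)) (c / M k)"

definition heavy_set :: "nat \<Rightarrow> real \<Rightarrow> 'a set" where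
  "heavy_set k t = (\<Union>x\<in>heavy_keys k t. key_ball k x)"

lemma M_pos: "0 < M k"
  using M_ge[of k] by (smt (verit) zero_less_power)

lemma M_ge_1: "1 \<le> M k"
  using M_ge[of k] one_le_power[of "2::real" k] by linarith

lemma ln_M_pos: "0 < k \<Longrightarrow> 0 < ln (M k)"
  using M_ge[of k] one_less_power[of "2::real" k] by (intro ln_gt_zero) linarith

lemma N_ge_1: "1 \<le> N"
proof (rule ccontr)
  assume "\<not> 1 \<le> N"
  have le: "M k \<le> M 0" for k
  proof (induction k)
    case (Suc k)
    have "M (Suc k) \<le> N * M k" by (rule M_Suc)
    also have "\<dots> \<le> 1 * M k" using \<open>\<not> 1 \<le> N\<close> M_pos[of k] by (intro mult_right_mono) auto
    finally show ?case using Suc by simp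
  qed simp
  obtain k :: nat where "M 0 < 2 ^ k" using real_arch_pow[of 2 "M 0"] by auto
  with M_ge[of k] le[of k] show False by simp
qed

lemma filterlim_M: "filterlim M at_top sequentially"
proof (rule filterlim_at_top_mono)
  show "filterlim (\<lambda>k. 2 ^ k :: real) at_top sequentially" by real_asymp
qed (simp add: M_ge)

lemma M_powr_le: "0 \<le> e \<Longrightarrow> M k powr (- e) \<le> (2 powr (- e)) ^ k"
proof -
  assume "0 \<le> e"
  have "M k powr (- e) \<le> (2 ^ k) powr (- e)"
    by (rule powr_mono2') (use M_ge \<open>0 \<le> e\<close> in auto)
  also have "\<dots> = (2 powr (- e)) ^ k"
    by (simp add: powr_powr powr_realpow[symmetric] mult.commute)
  finally show ?thesis .
qed

lemma M_powr_tendsto_0: "0 < e \<Longrightarrow> (\<lambda>k. C * M k powr (- e)) \<longlonglongrightarrow> 0"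
  using tendsto_mult_right_zero[OF tendsto_neg_powr[OF _ filterlim_M], of "- e" C] by simp

lemma closed_key_ball: "closed (key_ball k x)"
  by (simp add: key_ball_def)

lemma finite_heavy_keys: "finite (heavy_keys k t)"
  using finite_keys[of k] by (simp add: heavy_keys_def)

lemma closed_heavy_set: "closed (heavy_set k t)"
  unfolding heavy_set_def by (intro closed_UN finite_heavy_keys ballI closed_key_ball)

lemma prob_UN_fibre:
  assumes "finite S"
  shows "prob (\<Union>x\<in>S. fibre k x) = (\<Sum>x\<in>S. prob (fibre k x))"
  using assms by (intro finite_measure_finite_Union) (auto simp: disjoint_family_on_def sets_fibre)

lemma card_heavy_keys: "real (card (heavy_keys k t)) \<le> M k powr t"
proof -
  have "real (card (heavy_keys k t)) * M k powr (- t) \<le> (\<Sum>x\<in>heavy_keys k t. prob (fibre k x))"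
    using sum_bounded_below[of "heavy_keys k t" "M k powr (- t)" "\<lambda>x. prob (fibre k x)"]
    by (auto simp: heavy_keys_def)
  also have "\<dots> = prob (\<Union>x\<in>heavy_keys k t. fibre k x)"
    by (rule prob_UN_fibre[symmetric, OF finite_heavy_keys])
  also have "\<dots> \<le> 1" by simp
  finally show ?thesis using M_pos[of k] by (simp add: powr_minus field_simps)
qed

lemma coding_in_heavy_set:
  assumes "w \<in> space \<nu>" "M k powr (- t) \<le> prob (fibre k (key k w))"
  shows "\<pi> w \<in> heavy_set k t"
proof -
  let ?v = "inv_into (space \<nu>) (key k) (key k w)"
  have "?v \<in> space \<nu>" "key k ?v = key k w"
    using assms(1) by (auto intro: inv_into_into f_inv_into_f)
  then have "\<pi> w \<in> key_ball k (key k w)"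
    using dist_fibre[of ?v w k] assms(1) by (simp add: key_ball_def)
  with assms show ?thesis by (auto simp: heavy_set_def heavy_keys_def)
qed

lemma diameter_key_ball: "diameter (key_ball k x) \<le> 2 * c / M k"
proof -
  have "dist y z \<le> 2 * c / M k" if "y \<in> key_ball k x" "z \<in> key_ball k x" for y z
    using that dist_triangle3[of y z "\<pi> (inv_into (space \<nu>) (key k) x)"] by (auto simp: key_ball_def)
  then show ?thesis
    using M_pos[of k] c_pos by (auto simp: diameter_def key_ball_def intro!: cSUP_least)
qed

section \<open>Upper bounds: carriers made of heavy squares\<close>

text \<open>If \<open>ratio k < s\<close>, then \<open>exp (- H k)\<close> is at least
  \<open>M k powr (- s)\<close>; the gap \<open>t - s\<close> absorbs the fluctuation factor in
  \<open>entropy\<close>.\<close>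

lemma AE_heavy:
  assumes "s < t"
  shows "AE w in \<nu>. \<forall>\<^sub>F k in sequentially. ratio k < ereal s \<longrightarrow> \<pi> w \<in> heavy_set k t"
proof -
  have "0 < t - s" using assms by simp
  from entropy[OF this] show ?thesis
  proof (rule AE_mp, intro AE_I2 impI)
    fix w assume w: "w \<in> space \<nu>"
      and ev: "\<forall>\<^sub>F k in sequentially.
        M k powr (- (t - s)) * exp (- H k) \<le> prob (fibre k (key k w)) \<and>
        prob (fibre k (key k w)) \<le> M k powr (t - s) * exp (- H k)"
    from ev eventually_gt_at_top[of 0]
    show "\<forall>\<^sub>F k in sequentially. ratio k < ereal s \<longrightarrow> \<pi> w \<in> heavy_set k t"
    proof eventually_elim
      case (elim k)
      show ?case
      proof
        assume "ratio k < ereal s"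
        then have "H k \<le> s * ln (M k)"
          using ln_M_pos[OF elim(2)] by (simp add: field_simps)
        then have "M k powr (- s) \<le> exp (- H k)"
          using M_pos[of k] by (simp add: powr_def)
        then have "M k powr (- (t - s)) * M k powr (- s) \<le> M k powr (- (t - s)) * exp (- H k)"
          by (intro mult_left_mono) auto
        also have "M k powr (- (t - s)) * M k powr (- s) = M k powr (- t)"
          by (simp add: powr_add[symmetric])
        finally show "\<pi> w \<in> heavy_set k t"
          using elim by (intro coding_in_heavy_set[OF w]) linarith
      qed
    qed
  qed
qed

text \<open>Level \<open>k\<close> needs at most \<open>M k powr t\<close> balls of weight about
  \<open>M k powr (- s)\<close>, so its cost is geometric in \<open>k\<close> and the levels from
  \<open>j\<close> on form a cover of vanishing cost. \<open>P\<close> will select the levels where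
  \<open>ratio\<close> is near its liminf.\<close>

lemma heavy_limsup_null:
  assumes "t < s" "0 < s"
  shows "hausdorff_measure s (\<Inter>j. \<Union>k\<in>{k. j \<le> k \<and> P k}. heavy_set k t) = 0"
    (is "hausdorff_measure s ?A = 0")
proof -
  define q where "q = (2::real) powr (- (s - t))"
  have q: "0 < q" "q < 1" using assms by (auto simp: q_def powr_less_one)
  have "hausdorff_premeasure s \<delta> ?A = 0" if \<delta>: "0 < \<delta>" for \<delta>
  proof (rule antisym[OF ennreal_le_epsilon zero_le])
    fix e :: real assume "0 < e"
    have "(\<lambda>k. (2 * c) powr s * q ^ k / (1 - q)) \<longlonglongrightarrow> (2 * c) powr s * 0 / (1 - q)"
      using q by (intro tendsto_intros) auto
    then have "\<forall>\<^sub>F k in sequentially. (2 * c) powr s * q ^ k / (1 - q) < e"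
      by (rule order_tendstoD) (use \<open>0 < e\<close> in simp)
    moreover have "\<forall>\<^sub>F k in sequentially. 2 * c / \<delta> \<le> M k"
      using filterlim_M by (simp add: filterlim_at_top)
    ultimately have "\<forall>\<^sub>F k in sequentially. (2 * c) powr s * q ^ k / (1 - q) < e \<and> 2 * c / \<delta> \<le> M k"
      by (rule eventually_conj)
    then obtain j where j: "\<And>k. k \<ge> j \<Longrightarrow> 2 * c / \<delta> \<le> M k"
        "(2 * c) powr s * q ^ j / (1 - q) < e"
      by (auto simp: eventually_sequentially)
    \<comment> \<open>\<open>hausdorff_premeasure\<close> takes one sequence of sets, so the keys of
      each level are numbered and \<open>prod_decode\<close> runs through the pairs of level and
      number. Surplus pairs receive the empty set, of weight 0.\<close>
    define en where "en k = (SOME f. bij_betw f {0..<card (heavy_keys k t)} (heavy_keys k t))" for k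
    have en: "bij_betw (en k) {0..<card (heavy_keys k t)} (heavy_keys k t)" for k
      unfolding en_def by (rule someI_ex[OF ex_bij_betw_nat_finite[OF finite_heavy_keys]])
    define V where "V = (\<lambda>(k, i). if j \<le> k \<and> i < card (heavy_keys k t) then key_ball k (en k i) else {})"
    have dV: "diameter (key_ball k x) \<le> \<delta>" if "j \<le> k" for k x
    proof -
      have "2 * c / M k \<le> \<delta>" using j(1)[OF that] M_pos[of k] \<delta> by (simp add: field_simps)
      with diameter_key_ball[of k x] show ?thesis by linarith
    qed
    have cover: "?A \<subseteq> (\<Union>i. V (prod_decode i))"
    proof
      fix y assume "y \<in> ?A"
      then have "y \<in> (\<Union>k\<in>{k. j \<le> k \<and> P k}. heavy_set k t)" by blast
      then obtain k x where k: "j \<le> k" "x \<in> heavy_keys k t" "y \<in> key_ball k x"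
        by (auto simp: heavy_set_def)
      then obtain i where "i < card (heavy_keys k t)" "en k i = x"
        using bij_betw_imp_surj_on[OF en[of k]] by (metis atLeastLessThan_iff imageE)
      with k have "y \<in> V (prod_decode (prod_encode (k, i)))" by (simp add: V_def)
      then show "y \<in> (\<Union>i. V (prod_decode i))" by blast
    qed
    have small: "bounded (V (prod_decode i)) \<and> diameter (V (prod_decode i)) \<le> \<delta>" for i
      using dV \<delta> by (cases "prod_decode i") (auto simp: V_def key_ball_def)
    have "hausdorff_premeasure s \<delta> ?A \<le> (\<Sum>i. diam_pow s (V (prod_decode i)))"
      unfolding hausdorff_premeasure_def
      by (rule Inf_lower, rule CollectI, rule exI[of _ "\<lambda>i. V (prod_decode i)"]) (use cover small in blast)
    also have "\<dots> = (\<Sum>k. \<Sum>i. diam_pow s (V (k, i)))"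
      by (rule suminf_ennreal_2dimen) simp
    also have "\<dots> \<le> (\<Sum>k. ennreal (if j \<le> k then (2 * c) powr s * q ^ k else 0))"
    proof (rule suminf_le)
      fix k
      let ?b = "if j \<le> k then (2 * c) powr s * q ^ k else 0"
      have "(\<Sum>i. diam_pow s (V (k, i))) = (\<Sum>i<card (heavy_keys k t). diam_pow s (V (k, i)))"
        by (rule suminf_finite) (auto simp: V_def diam_pow_def)
      also have "\<dots> \<le> ennreal ?b"
      proof (cases "j \<le> k")
        case True
        have "diam_pow s (V (k, i)) \<le> ennreal ((2 * c / M k) powr s)" if "i < card (heavy_keys k t)" for i
          using that True \<open>0 < s\<close> diameter_key_ball[of k "en k i"]
          by (auto simp: V_def diam_pow_def intro!: ennreal_leI powr_mono2 diameter_ge_0 simp: key_ball_def)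
        then have "(\<Sum>i<card (heavy_keys k t). diam_pow s (V (k, i)))
            \<le> of_nat (card (heavy_keys k t)) * ennreal ((2 * c / M k) powr s)"
          using sum_bounded_above[of "{..<card (heavy_keys k t)}" "\<lambda>i. diam_pow s (V (k, i))"] by simp
        also have "\<dots> = ennreal (card (heavy_keys k t) * (2 * c / M k) powr s)"
          by (simp add: ennreal_of_nat_eq_real_of_nat ennreal_mult)
        also have "\<dots> \<le> ennreal ?b"
        proof (rule ennreal_leI)
          have "card (heavy_keys k t) * (2 * c / M k) powr s \<le> M k powr t * (2 * c / M k) powr s"
            by (intro mult_right_mono card_heavy_keys) simp
          also have "\<dots> = (2 * c) powr s * M k powr (- (s - t))"
            using M_pos[of k] c_pos by (simp add: powr_divide powr_diff)
          also have "\<dots> \<le> (2 * c) powr s * q ^ k"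
            unfolding q_def using assms by (intro mult_left_mono M_powr_le) auto
          finally show "card (heavy_keys k t) * (2 * c / M k) powr s \<le> ?b" using True by simp
        qed
        finally show ?thesis .
      qed (simp add: V_def diam_pow_def)
      finally show "(\<Sum>i. diam_pow s (V (k, i))) \<le> ennreal ?b" .
    qed auto
    also have "\<dots> = ennreal ((2 * c) powr s * q ^ j / (1 - q))"
      using q by (intro suminf_ennreal_eq geometric_tail_sums) auto
    also have "\<dots> \<le> ennreal e" using j(2) by (intro ennreal_leI) simp
    finally show "hausdorff_premeasure s \<delta> ?A \<le> 0 + ennreal e" by simp
  qed
  then show ?thesis by (simp add: hausdorff_measure_def)
qed


text \<open>A packing ball of radius \<open>r\<close> is assigned the first level whose key balls
  have diameter at most \<open>r\<close>. Two balls of one level cannot have centres in the same key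
  ball, since one would then contain the centre of the other. So level \<open>k\<close> carries at
  most \<open>M k powr t\<close> balls, and the weights sum to a geometric tail.\<close>

lemma heavy_tail_null:
  assumes "t < s" "0 < s"
  shows "packing_premeasure s (\<Inter>k\<in>{j..}. heavy_set k t) = 0"
    (is "packing_premeasure s ?A = 0")
proof (rule antisym[OF ennreal_le_epsilon zero_le])
  fix e :: real assume "0 < e"
  define q where "q = (2::real) powr (- (s - t))"
  have q: "0 < q" "q < 1" using assms by (auto simp: q_def powr_less_one)
  \<comment> \<open>Minimality of \<open>lev r\<close> gives \<open>r * M k < 2 * c\<close> one
    level earlier; \<open>M_Suc\<close> costs the factor \<open>N\<close>, and the weight uses
    \<open>2 * r\<close>.\<close>
  define C where "C = (4 * c * N) powr s"
  have "(\<lambda>k. C * q ^ k / (1 - q)) \<longlonglongrightarrow> C * 0 / (1 - q)"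
    using q by (intro tendsto_intros) auto
  then have "\<forall>\<^sub>F k in sequentially. C * q ^ k / (1 - q) < e"
    by (rule order_tendstoD) (use \<open>0 < e\<close> in simp)
  then obtain K where K: "j \<le> K" "C * q ^ K / (1 - q) < e"
    using eventually_happens'[OF sequentially_bot eventually_conj[OF _ eventually_ge_at_top[of j]]] by blast
  \<comment> \<open>For \<open>r\<close> up to \<delta> the threshold \<open>2 * c / r\<close>
    exceeds each of \<open>M 0\<close>, ..., \<open>M K\<close>, which forces \<open>lev r\<close>
    beyond \<open>K\<close>. The sum replaces a maximum because \<open>M\<close> need not be
    monotone.\<close>
  define \<delta> where "\<delta> = 2 * c / (1 + (\<Sum>k\<le>K. M k))"
  have sumM: "0 \<le> (\<Sum>k\<le>K. M k)" by (intro sum_nonneg less_imp_le M_pos)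
  have "0 < \<delta>" using c_pos sumM by (simp add: \<delta>_def)
  define lev where "lev r = (LEAST k. 2 * c / r \<le> M k)" for r
  have lev: "K < lev r" "2 * c / M (lev r) \<le> r" "(2 * r) powr s \<le> C * M (lev r) powr (- s)"
    if r: "0 < r" "r \<le> \<delta>" for r
  proof -
    have "\<exists>k. 2 * c / r \<le> M k"
      using filterlim_M by (auto simp: filterlim_at_top eventually_sequentially)
    then have 1: "2 * c / r \<le> M (lev r)" unfolding lev_def by (rule LeastI_ex)
    have "M k < 2 * c / r" if "k \<le> K" for k
    proof -
      have "M k \<le> (\<Sum>k\<le>K. M k)" using that by (intro member_le_sum less_imp_le M_pos) auto
      also have "\<dots> < 2 * c / \<delta>" using c_pos sumM by (simp add: \<delta>_def)
      also have "\<dots> \<le> 2 * c / r" using r c_pos by (intro divide_left_mono) auto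
      finally show ?thesis .
    qed
    with 1 show K: "K < lev r" by (meson leD leI)
    show "2 * c / M (lev r) \<le> r" using 1 r M_pos[of "lev r"] by (simp add: field_simps)
    obtain k where k: "lev r = Suc k" using K by (cases "lev r") auto
    have "M k < 2 * c / r" using not_less_Least[of k "\<lambda>k. 2 * c / r \<le> M k"] k by (simp add: lev_def not_le)
    then have "r * M k < 2 * c" using r by (simp add: field_simps)
    have "r * M (lev r) \<le> r * (N * M k)" using r k M_Suc[of k] by simp
    also have "\<dots> = N * (r * M k)" by simp
    also have "\<dots> \<le> N * (2 * c)" using \<open>r * M k < 2 * c\<close> N_ge_1 by (intro mult_left_mono) auto
    finally have "2 * r \<le> 4 * c * N / M (lev r)" using M_pos[of "lev r"] by (simp add: field_simps)
    then have "(2 * r) powr s \<le> (4 * c * N / M (lev r)) powr s"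
      using r assms by (intro powr_mono2) auto
    also have "\<dots> = C * M (lev r) powr (- s)"
      using M_pos[of "lev r"] c_pos N_ge_1 by (simp add: C_def powr_divide powr_minus field_simps)
    finally show "(2 * r) powr s \<le> C * M (lev r) powr (- s)" .
  qed
  have "(\<Sum>\<^sub>\<infinity>(x, r)\<in>B. ennreal ((2 * r) powr s)) \<le> ennreal e" if B: "B \<in> packings \<delta> ?A" for B
  proof (rule infsum_le_finite_sums)
    show "(\<lambda>(x, r). ennreal ((2 * r) powr s)) summable_on B" by (rule nonneg_summable_on_complete) auto
    fix F assume F: "finite F" "F \<subseteq> B"
    have FA: "fst b \<in> ?A" "0 < snd b" "snd b \<le> \<delta>" if "b \<in> F" for b
    proof -
      have "b \<in> ?A \<times> {0<..\<delta>}" using B F(2) that unfolding packings_def by blast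
      then show "fst b \<in> ?A" "0 < snd b" "snd b \<le> \<delta>" by (auto simp only: mem_Times_iff greaterThanAtMost_iff)
    qed
    have disj: "cball (fst b) (snd b) \<inter> cball (fst b') (snd b') = {}" if "b \<in> F" "b' \<in> F" "b \<noteq> b'" for b b'
    proof -
      have "disjoint_family_on (\<lambda>b. cball (fst b) (snd b)) B"
        using B by (simp add: packings_def case_prod_unfold)
      then show ?thesis using F(2) that by (blast dest: disjoint_family_onD)
    qed
    have fibre_bound: "(\<Sum>b\<in>{b \<in> F. lev (snd b) = k}. (2 * snd b) powr s) \<le> C * q ^ k" for k
    proof (cases "{b \<in> F. lev (snd b) = k} = {}")
      case True
      then show ?thesis using q by (simp only: sum.empty) (simp add: C_def)
    next
      case False
      then obtain b where "b \<in> F" "lev (snd b) = k" by auto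
      then have "K < k" using lev(1)[of "snd b"] FA(2,3)[of b] by simp
      define f where "f b = (SOME x. x \<in> heavy_keys k t \<and> fst b \<in> key_ball k x)" for b :: "'a \<times> real"
      have f: "f b \<in> heavy_keys k t \<and> fst b \<in> key_ball k (f b)" if "b \<in> F" for b
        unfolding f_def
      proof (rule someI_ex)
        show "\<exists>x. x \<in> heavy_keys k t \<and> fst b \<in> key_ball k x"
          using FA(1)[of b] that \<open>K < k\<close> K(1) by (auto simp: heavy_set_def)
      qed
      have "inj_on f {b \<in> F. lev (snd b) = k}"
      proof (rule inj_onI, rule ccontr)
        fix b b' assume "b \<in> {b \<in> F. lev (snd b) = k}" "b' \<in> {b \<in> F. lev (snd b) = k}"
          and eq: "f b = f b'" and "b \<noteq> b'"
        then have b: "b \<in> F" "lev (snd b) = k" "b' \<in> F" by auto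
        have "dist (fst b) (fst b') \<le> 2 * c / M k"
          using f[OF b(1)] f[OF b(3)] eq
            dist_triangle3[of "fst b" "fst b'" "\<pi> (inv_into (space \<nu>) (key k) (f b'))"]
          by (auto simp: key_ball_def)
        also have "\<dots> \<le> snd b" using lev(2)[OF FA(2,3)[OF b(1)]] b(2) by simp
        finally have "fst b' \<in> cball (fst b) (snd b)" by simp
        moreover have "fst b' \<in> cball (fst b') (snd b')" using FA(2)[OF b(3)] by simp
        ultimately show False using disj[OF b(1,3) \<open>b \<noteq> b'\<close>] by blast
      qed
      then have card: "card {b \<in> F. lev (snd b) = k} \<le> card (heavy_keys k t)"
        by (rule card_inj_on_le) (use f finite_heavy_keys in auto)
      have "(\<Sum>b\<in>{b \<in> F. lev (snd b) = k}. (2 * snd b) powr s)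
          \<le> card {b \<in> F. lev (snd b) = k} * (C * M k powr (- s))"
      proof (rule sum_bounded_above)
        fix b assume "b \<in> {b \<in> F. lev (snd b) = k}"
        then show "(2 * snd b) powr s \<le> C * M k powr (- s)" using lev(3)[OF FA(2,3), of b] by auto
      qed
      also have "\<dots> \<le> M k powr t * (C * M k powr (- s))"
        using card card_heavy_keys[of k t] by (intro mult_right_mono) (auto simp: C_def)
      also have "\<dots> = C * M k powr (- (s - t))" using M_pos[of k] by (simp add: powr_add[symmetric])
      also have "\<dots> \<le> C * q ^ k"
        unfolding q_def using assms by (intro mult_left_mono M_powr_le) (auto simp: C_def)
      finally show ?thesis .
    qed
    let ?lev = "\<lambda>b. lev (snd b)"
    have "(\<Sum>b\<in>F. (2 * snd b) powr s) = (\<Sum>k\<in>?lev ` F. \<Sum>b\<in>{b \<in> F. lev (snd b) = k}. (2 * snd b) powr s)"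
      by (rule sum.image_gen[OF F(1)])
    also have "\<dots> \<le> (\<Sum>k\<in>?lev ` F. if K \<le> k then C * q ^ k else 0)"
    proof (rule sum_mono)
      fix k assume "k \<in> ?lev ` F"
      then have "K < k" using lev(1)[OF FA(2,3)] by auto
      then show "(\<Sum>b\<in>{b \<in> F. lev (snd b) = k}. (2 * snd b) powr s) \<le> (if K \<le> k then C * q ^ k else 0)"
        using fibre_bound[of k] by simp
    qed
    also have "\<dots> \<le> (\<Sum>k. if K \<le> k then C * q ^ k else 0)"
      using geometric_tail_sums[OF q, of K C] F(1) q by (intro sum_le_suminf) (auto simp: C_def sums_iff)
    also have "\<dots> = C * q ^ K / (1 - q)" using geometric_tail_sums[OF q, of K C] by (simp add: sums_iff)
    also have "\<dots> \<le> e" using K(2) by simp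
    finally have "ennreal (\<Sum>b\<in>F. (2 * snd b) powr s) \<le> ennreal e" by (rule ennreal_leI)
    then show "(\<Sum>(x, r)\<in>F. ennreal ((2 * r) powr s)) \<le> ennreal e"
      by (simp add: sum_ennreal case_prod_unfold)
  qed
  then have "packing_premeasure s ?A \<le> ennreal e"
    unfolding packing_premeasure_def using \<open>0 < \<delta>\<close> by (intro INF_lower2[of \<delta>] SUP_least) auto
  then show "packing_premeasure s ?A \<le> 0 + ennreal e" by simp
qed

lemma frequently_ratio_less: "liminf ratio < x \<Longrightarrow> \<exists>\<^sub>F k in sequentially. ratio k < x"
  using Liminf_bounded[of x ratio sequentially] by (auto simp: frequently_def not_less)

lemma frequently_ratio_greater: "x < limsup ratio \<Longrightarrow> \<exists>\<^sub>F k in sequentially. x < ratio k"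
  using Limsup_bounded[of ratio x sequentially] by (auto simp: frequently_def not_less)

lemma ratio_nonneg: "0 \<le> liminf ratio"
  by (rule Liminf_bounded) (auto simp: H_nonneg M_ge_1 intro!: always_eventually)

text \<open>Infinitely many levels have \<open>ratio k < t\<close>, and almost every point lies in
  the heavy set at all late ones among them, hence in the limsup set over these levels. Of the two
  gaps, \<open>t < u\<close> pays for the fluctuation of masses and \<open>u < s\<close> for the
  convergence of the covering series.\<close>

lemma hausdorff_null_carrier:
  assumes "liminf ratio < ereal s"
  obtains A where "A \<in> sets borel" "AE w in \<nu>. \<pi> w \<in> A" "hausdorff_measure s A = 0"
proof -
  have "0 < s" using ratio_nonneg assms by (metis ereal_less(2) order.strict_trans1)
  obtain t where t: "liminf ratio < ereal t" "t < s"
    using ereal_dense2[OF assms] by auto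
  obtain u where u: "t < u" "u < s" using dense[OF t(2)] by auto
  let ?A = "\<Inter>j. \<Union>k\<in>{k. j \<le> k \<and> ratio k < ereal t}. heavy_set k u"
  have "?A \<in> sets borel"
    by (intro sets.countable_INT sets.countable_UN'' borel_closed closed_heavy_set) (auto intro: borel_closed closed_heavy_set)
  moreover from AE_heavy[OF u(1)] have "AE w in \<nu>. \<pi> w \<in> ?A"
  proof eventually_elim
    case (elim w)
    have "\<exists>k\<ge>j. ratio k < ereal t \<and> \<pi> w \<in> heavy_set k u" for j
      using frequently_ex[OF frequently_eventually_frequently[OF frequently_ratio_less[OF t(1)]
            eventually_conj[OF elim eventually_ge_at_top[of j]]]] by auto
    then show ?case by fastforce
  qed
  moreover have "hausdorff_measure s ?A = 0"
    by (rule heavy_limsup_null[OF u(2) \<open>0 < s\<close>])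
  ultimately show ?thesis by (rule that)
qed

text \<open>Here all late levels have \<open>ratio k < t\<close>, so almost every point lies in some
  \<open>?F j\<close>. The carrier is cut into these pieces because \<open>heavy_tail_null\<close>
  needs one starting level for all points, and \<open>packing_measure\<close> permits a countable
  decomposition.\<close>

lemma packing_null_carrier:
  assumes "limsup ratio < ereal s"
  obtains A where "A \<in> sets borel" "AE w in \<nu>. \<pi> w \<in> A" "packing_measure s A = 0"
proof -
  have "0 < s" using ratio_nonneg assms Liminf_le_Limsup[of sequentially ratio]
    by (metis ereal_less(2) order.strict_trans1 order_trans trivial_limit_sequentially)
  obtain t where t: "limsup ratio < ereal t" "t < s"
    using ereal_dense2[OF assms] by auto
  obtain u where u: "t < u" "u < s" using dense[OF t(2)] by auto
  let ?F = "\<lambda>j. \<Inter>k\<in>{j..}. heavy_set k u"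
  let ?A = "\<Union>j. ?F j"
  have "?A \<in> sets borel"
    by (intro sets.countable_UN) (auto intro!: borel_closed closed_INT closed_heavy_set)
  moreover from AE_heavy[OF u(1)] have "AE w in \<nu>. \<pi> w \<in> ?A"
  proof eventually_elim
    case (elim w)
    from elim Limsup_lessD[OF t(1)] have "\<forall>\<^sub>F k in sequentially. \<pi> w \<in> heavy_set k u"
      by eventually_elim simp
    then show ?case by (auto simp: eventually_sequentially)
  qed
  moreover have "packing_measure s ?A = 0"
  proof -
    have "packing_measure s ?A \<le> (\<Sum>i. packing_premeasure s (?F i))"
      unfolding packing_measure_def by (rule Inf_lower, rule CollectI, rule exI[of _ ?F]) simp
    then show ?thesis by (simp add: heavy_tail_null[OF u(2) \<open>0 < s\<close>])
  qed
  ultimately show ?thesis by (rule that)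
qed

text \<open>\<open>S\<close> need not be measurable, so the sets of words satisfying the separation estimate from some level on
  need not be either.\<close>

lemma AE_notin_if_small_covers:
  assumes "\<And>e. 0 < e \<Longrightarrow> \<exists>U\<in>events. S \<subseteq> U \<and> prob U \<le> e"
  shows "AE w in \<nu>. w \<notin> S"
proof -
  have "\<forall>i. \<exists>U. U \<in> events \<and> S \<subseteq> U \<and> prob U \<le> 1 / real (Suc i)"
  proof
    fix i show "\<exists>U. U \<in> events \<and> S \<subseteq> U \<and> prob U \<le> 1 / real (Suc i)"
      using assms[of "1 / real (Suc i)"] by auto
  qed
  from choice[OF this] obtain U
    where U: "\<And>i. U i \<in> events" "\<And>i. S \<subseteq> U i" "\<And>i. prob (U i) \<le> 1 / real (Suc i)"
    by blast
  have ev: "(\<Inter>i. U i) \<in> events" using U by auto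
  have "prob (\<Inter>i. U i) \<le> 0"
  proof (rule field_le_epsilon)
    fix e :: real assume "0 < e"
    then obtain i where "1 / real (Suc i) < e" by (rule nat_approx_posE)
    moreover have "prob (\<Inter>i. U i) \<le> prob (U i)" using U by (intro finite_measure_mono) auto
    ultimately show "prob (\<Inter>i. U i) \<le> 0 + e" using U(3)[of i] by linarith
  qed
  then have "(\<Inter>i. U i) \<in> null_sets \<nu>"
    using ev by (auto simp: null_sets_def emeasure_eq_measure measure_le_0_iff)
  then show ?thesis by (rule AE_I') (use U(2) in auto)
qed

section \<open>Lower bounds: mass estimates on regular words\<close>

text \<open>A common starting level \<open>j\<close> makes the two eventual estimates uniform.
  Countably many of these sets exhaust almost every word, so a null statement may be proved for one
  \<open>j\<close> at a time.\<close>

definition regular_words :: "real \<Rightarrow> real \<Rightarrow> nat \<Rightarrow> 'w set" where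
  "regular_words e d j = {w \<in> space \<nu>. \<forall>k\<ge>j.
     prob (fibre k (key k w)) \<le> M k powr e * exp (- H k) \<and>
     (\<forall>v\<in>space \<nu>. dist (\<pi> w) (\<pi> v) < M k powr (- (1 + d)) \<longrightarrow> key k v = key k w)}"

lemma AE_regular_words:
  assumes "0 < e" "0 < d"
  shows "AE w in \<nu>. \<exists>j. w \<in> regular_words e d j"
  using entropy[OF assms(1)] separation[OF assms(2)] AE_space
proof eventually_elim
  case (elim w)
  from elim(1,2) have "\<forall>\<^sub>F k in sequentially. prob (fibre k (key k w)) \<le> M k powr e * exp (- H k) \<and>
      (\<forall>v\<in>space \<nu>. dist (\<pi> w) (\<pi> v) < M k powr (- (1 + d)) \<longrightarrow> key k v = key k w)"
    by eventually_elim simp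
  then obtain j where
    "\<forall>k\<ge>j. prob (fibre k (key k w)) \<le> M k powr e * exp (- H k) \<and>
      (\<forall>v\<in>space \<nu>. dist (\<pi> w) (\<pi> v) < M k powr (- (1 + d)) \<longrightarrow> key k v = key k w)"
    unfolding eventually_sequentially ..
  with elim(3) show ?case by (intro exI[of _ j]) (simp add: regular_words_def)
qed

lemma fibre_mass_le:
  assumes "0 < k" "t * ln (M k) \<le> H k" "w \<in> regular_words e d j" "j \<le> k"
  shows "prob (fibre k (key k w)) \<le> M k powr (- (t - e))"
proof -
  have "exp (- H k) \<le> M k powr (- t)" using assms M_pos[of k] by (simp add: powr_def)
  then have "M k powr e * exp (- H k) \<le> M k powr e * M k powr (- t)" by (intro mult_left_mono) auto
  also have "\<dots> = M k powr (- (t - e))" by (simp add: powr_add[symmetric])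
  finally show ?thesis using assms by (auto simp: regular_words_def)
qed

text \<open>The loss from using radius \<open>M k powr (- (1 + d))\<close> takes a quarter of the
  gap \<open>t - s\<close>. The fluctuation \<open>e\<close> of the masses takes another quarter,
  which leaves a positive remainder.\<close>

lemma exponent_slack:
  assumes "0 \<le> s" "s < t"
  obtains d :: real where "0 < d" "s * (1 + d) \<le> s + (t - s) / 4"
proof
  show "0 < (t - s) / (4 * (s + 1))" using assms by simp
  have "s / (s + 1) \<le> 1" using assms by simp
  then have "s / (s + 1) * (t - s) / 4 \<le> 1 * (t - s) / 4" using assms by (intro divide_right_mono mult_right_mono) auto
  then show "s * (1 + (t - s) / (4 * (s + 1))) \<le> s + (t - s) / 4" by (simp add: algebra_simps)
qed

text \<open>Mass distribution principle on regular words: a set of diameter at most \<open>r\<close>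
  meets the images of regular words from only one class, at the level where
  \<open>M k powr (- (1 + d))\<close> is just above \<open>r\<close>, and that class has mass at
  most \<open>C * r powr s\<close>. A cover of small cost therefore catches little mass.\<close>

lemma hausdorff_null_AE_notin:
  assumes "0 \<le> s" "ereal s < liminf ratio" "hausdorff_measure s A = 0"
  shows "AE w in \<nu>. \<pi> w \<notin> A"
proof -
  obtain t where t: "s < t" "ereal t < liminf ratio" using ereal_dense2[OF assms(2)] by auto
  obtain d where d: "0 < d" "s * (1 + d) \<le> s + (t - s) / 4" using exponent_slack[OF assms(1) t(1)] by blast
  define e where "e = (t - s) / 4"
  have "0 < e" using t by (simp add: e_def)
  have "\<forall>\<^sub>F k in sequentially. ereal t < ratio k" by (rule less_LiminfD[OF t(2)])
  then obtain k0 where k0: "\<And>k. k0 \<le> k \<Longrightarrow> t < H k / ln (M k)" by (auto simp: eventually_sequentially)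
  have notin: "AE w in \<nu>. w \<notin> {w \<in> regular_words e d j. \<pi> w \<in> A}" for j
  proof (rule AE_notin_if_small_covers)
    fix b :: real assume "0 < b"
    \<comment> \<open>From level \<open>i\<close> on the regularity estimates hold and
      \<open>H k / ln (M k)\<close> exceeds \<open>t\<close>; \<open>Suc\<close> keeps
      \<open>ln (M k)\<close> positive. The halving in \<open>a\<close> supplies the strict
      inequality that the separation estimate asks for.\<close>
    define i where "i = Suc (max j k0)"
    define a where "a = M i powr (- (1 + d)) / 2"
    \<comment> \<open>The mass is estimated at level \<open>k\<close>, but \<open>r\<close> is
      bounded below only through level \<open>Suc k\<close>; \<open>C\<close> is the price of that
      one step by \<open>M_Suc\<close>.\<close>
    define C where "C = N powr (s * (1 + d))"
    have a: "0 < a" using M_pos[of i] by (simp add: a_def)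
    have C: "0 < C" using N_ge_1 by (simp add: C_def)
    have fib: "\<exists>G\<in>events. {w \<in> regular_words e d j. \<pi> w \<in> U} \<subseteq> G \<and> prob G \<le> C * r powr s"
      if U: "bounded U" "diameter U \<le> r" and r: "0 < r" "r \<le> a" for U r
    proof (cases "{w \<in> regular_words e d j. \<pi> w \<in> U} = {}")
      case True
      then show ?thesis using C by (intro bexI[of _ "{}"]) auto
    next
      case False
      then obtain w where w: "w \<in> regular_words e d j" "\<pi> w \<in> U" by auto
      have "(\<lambda>k. 1 * M k powr (- (1 + d))) \<longlonglongrightarrow> 0" using d by (intro M_powr_tendsto_0) simp
      then have "\<forall>\<^sub>F k in sequentially. M (Suc k) powr (- (1 + d)) < r"
        using r by (intro order_tendstoD[OF LIMSEQ_Suc]) auto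
      then have ex: "\<exists>k. i \<le> k \<and> M (Suc k) powr (- (1 + d)) \<le> r"
        using eventually_happens'[OF sequentially_bot eventually_conj[OF _ eventually_ge_at_top[of i]]]
        by (meson less_imp_le)
      \<comment> \<open>Without monotonicity of \<open>M\<close> the least index from
        \<open>i\<close> on is the right choice: \<open>r < M k powr (- (1 + d))\<close> follows
        from minimality, or from \<open>r \<le> a\<close> when \<open>k = i\<close>.\<close>
      define k where "k = (LEAST k. i \<le> k \<and> M (Suc k) powr (- (1 + d)) \<le> r)"
      have k: "i \<le> k" "M (Suc k) powr (- (1 + d)) \<le> r"
        using LeastI_ex[OF ex] by (auto simp: k_def)
      have rk: "r < M k powr (- (1 + d))"
      proof (cases "k = i")
        case True
        then show ?thesis using r a by (simp add: a_def)
      next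
        case False
        with k obtain k' where "k = Suc k'" "i \<le> k'" by (cases k) auto
        then show ?thesis
          using not_less_Least[of k' "\<lambda>k. i \<le> k \<and> M (Suc k) powr (- (1 + d)) \<le> r"] by (simp add: k_def)
      qed
      have "{w \<in> regular_words e d j. \<pi> w \<in> U} \<subseteq> fibre k (key k w)"
      proof clarsimp
        fix v assume v: "v \<in> regular_words e d j" "\<pi> v \<in> U"
        have "dist (\<pi> w) (\<pi> v) \<le> r"
          using diameter_bounded_bound[OF U(1) w(2) v(2)] U(2) by linarith
        with rk w(1) v(1) k(1) show "v \<in> space \<nu> \<and> key k v = key k w"
          by (auto simp: regular_words_def i_def)
      qed
      moreover have "prob (fibre k (key k w)) \<le> C * r powr s"
      proof -
        have "t * ln (M k) \<le> H k"
          using k0[of k] ln_M_pos[of k] k(1) by (simp add: i_def pos_less_divide_eq less_imp_le)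
        then have "prob (fibre k (key k w)) \<le> M k powr (- (t - e))"
          using w k(1) by (intro fibre_mass_le[where j = j]) (auto simp: i_def)
        also have "\<dots> \<le> M k powr (- (s * (1 + d)))"
          using d(2) t(1) M_ge_1[of k] by (intro powr_mono) (auto simp: e_def field_simps)
        also have "\<dots> \<le> (M (Suc k) / N) powr (- (s * (1 + d)))"
          using M_Suc[of k] M_pos[of "Suc k"] N_ge_1 assms(1) d(1)
          by (intro powr_mono2') (auto simp: pos_divide_le_eq mult.commute)
        also have "\<dots> = C * M (Suc k) powr (- (s * (1 + d)))"
          using M_pos[of "Suc k"] N_ge_1 by (simp add: C_def powr_divide powr_minus_divide)
        also have "M (Suc k) powr (- (s * (1 + d))) = (M (Suc k) powr (- (1 + d))) powr s"
          by (simp add: powr_powr algebra_simps)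
        also have "C * \<dots> \<le> C * r powr s"
          using k(2) assms(1) C by (intro mult_left_mono powr_mono2) auto
        finally show ?thesis .
      qed
      ultimately show ?thesis by (intro bexI[OF _ sets_fibre[of k "key k w"]] conjI)
    qed
    \<comment> \<open>One third of \<open>b\<close> goes to the diameters of the cover, two thirds
      to the corrections \<open>b' * (1/2) ^ i\<close>, whose sum is \<open>2 * b'\<close>.\<close>
    define b' where "b' = b / (3 * C)"
    have b': "0 < b'" using \<open>0 < b\<close> C by (simp add: b'_def)
    have "hausdorff_premeasure s a A \<le> hausdorff_measure s A"
      unfolding hausdorff_measure_def using a by (intro SUP_upper) auto
    then have "hausdorff_premeasure s a A < ennreal b'" using assms(3) b' by simp
    then obtain U where U: "A \<subseteq> (\<Union>i. U i)" "\<And>i. bounded (U i)" "\<And>i. diameter (U i) \<le> a"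
        "(\<Sum>i. diam_pow s (U i)) < ennreal b'"
      unfolding hausdorff_premeasure_def Inf_less_iff by auto
    \<comment> \<open>A covering set may have diameter 0, so its diameter is replaced by a radius at least \<open>\<tau> i > 0\<close>
      whose total contribution is negligible.\<close>
    define \<tau> where "\<tau> i = min a ((b' * (1/2) ^ i) powr (1 / s))" for i :: nat
    have "\<exists>G\<in>events. {w \<in> regular_words e d j. \<pi> w \<in> U i} \<subseteq> G \<and>
        emeasure \<nu> G \<le> ennreal C * (diam_pow s (U i) + ennreal (b' * (1/2) ^ i))" for i
    proof (cases "U i = {}")
      case True
      then show ?thesis by (intro bexI[of _ "{}"]) auto
    next
      case False
      define r where "r = max (diameter (U i)) (\<tau> i)"
      have "0 < \<tau> i" using a b' by (simp add: \<tau>_def)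
      then have r: "diameter (U i) \<le> r" "0 < r" "r \<le> a"
        using U(3)[of i] by (auto simp: r_def less_max_iff_disj) (simp add: \<tau>_def)
      obtain G where G: "G \<in> events" "{w \<in> regular_words e d j. \<pi> w \<in> U i} \<subseteq> G" "prob G \<le> C * r powr s"
        using fib[OF U(2) r] by blast
      have "ennreal (r powr s) \<le> diam_pow s (U i) + ennreal (b' * (1/2) ^ i)"
      proof (cases "s = 0")
        case True
        then show ?thesis using False r by (simp add: diam_pow_def)
      next
        case s: False
        have "\<tau> i powr s \<le> ((b' * (1/2) ^ i) powr (1 / s)) powr s"
          using a b' assms(1) by (intro powr_mono2) (auto simp: \<tau>_def)
        also have "\<dots> = b' * (1/2) ^ i" using s b' by (simp add: powr_powr)
        finally have "\<tau> i powr s \<le> b' * (1/2) ^ i" .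
        moreover have "r = diameter (U i) \<or> r = \<tau> i" by (auto simp: r_def max_def)
        ultimately have "r powr s \<le> diameter (U i) powr s + b' * (1/2) ^ i"
          using b' by (elim disjE) (simp_all add: add_increasing)
        then show ?thesis
          using False s b' by (simp add: diam_pow_def ennreal_plus[symmetric] ennreal_leI del: ennreal_plus)
      qed
      then have "ennreal C * ennreal (r powr s) \<le> ennreal C * (diam_pow s (U i) + ennreal (b' * (1/2) ^ i))"
        by (rule mult_left_mono) simp
      moreover have "emeasure \<nu> G \<le> ennreal C * ennreal (r powr s)"
        using G(3) C by (simp add: emeasure_eq_measure ennreal_mult[symmetric] ennreal_leI)
      ultimately show ?thesis by (intro bexI[OF _ G(1)] conjI G(2)) (rule order_trans)
    qed
    then have "\<forall>i. \<exists>G. G \<in> events \<and> {w \<in> regular_words e d j. \<pi> w \<in> U i} \<subseteq> G \<and>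
        emeasure \<nu> G \<le> ennreal C * (diam_pow s (U i) + ennreal (b' * (1/2) ^ i))"
      unfolding Bex_def ..
    from choice[OF this] obtain G where G: "\<And>i. G i \<in> events"
        "\<And>i. {w \<in> regular_words e d j. \<pi> w \<in> U i} \<subseteq> G i"
        "\<And>i. emeasure \<nu> (G i) \<le> ennreal C * (diam_pow s (U i) + ennreal (b' * (1/2) ^ i))"
      by blast
    have "emeasure \<nu> (\<Union>i. G i) \<le> (\<Sum>i. emeasure \<nu> (G i))"
      using G(1) by (intro emeasure_subadditive_countably) auto
    also have "\<dots> \<le> (\<Sum>i. ennreal C * (diam_pow s (U i) + ennreal (b' * (1/2) ^ i)))"
      by (intro suminf_le G(3)) auto
    also have "\<dots> = ennreal C * ((\<Sum>i. diam_pow s (U i)) + (\<Sum>i. ennreal (b' * (1/2) ^ i)))"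
      by (simp add: suminf_add[symmetric])
    also have "(\<Sum>i. ennreal (b' * (1/2) ^ i)) = ennreal (b' * 2)"
      using b' sums_mult[OF geometric_sums[of "1/2::real"], of b'] by (intro suminf_ennreal_eq) auto
    also have "ennreal C * ((\<Sum>i. diam_pow s (U i)) + ennreal (b' * 2)) \<le> ennreal C * (ennreal b' + ennreal (b' * 2))"
      using U(4) by (intro mult_left_mono add_right_mono) auto
    also have "\<dots> = ennreal b"
      using C b' by (simp add: ennreal_plus[symmetric] ennreal_mult[symmetric] b'_def del: ennreal_plus)
    finally have "prob (\<Union>i. G i) \<le> b"
      using \<open>0 < b\<close> by (simp add: emeasure_eq_measure)
    moreover have "{w \<in> regular_words e d j. \<pi> w \<in> A} \<subseteq> (\<Union>i. G i)" using U(1) G(2) by blast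
    ultimately show "\<exists>G\<in>events. {w \<in> regular_words e d j. \<pi> w \<in> A} \<subseteq> G \<and> prob G \<le> b"
      using G(1) by blast
  qed
  from AE_regular_words[OF \<open>0 < e\<close> d(1)] AE_all_countable[THEN iffD2, OF allI, OF notin]
  show ?thesis by eventually_elim auto
qed

text \<open>At one level with large \<open>ratio\<close>, choosing one regular word in each class
  that meets \<open>F i\<close> gives well separated centres, hence a packing. The finite premeasure
  bounds the number of classes by \<open>C * (2 * r) powr (- s)\<close>, and each class has mass at
  most \<open>M k powr (- (t - e))\<close>. The product is small, and such levels occur arbitrarily
  late.\<close>

lemma packing_null_AE_notin:
  assumes "0 \<le> s" "ereal s < limsup ratio" "packing_measure s A = 0"
  shows "AE w in \<nu>. \<pi> w \<notin> A"
proof -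
  obtain t where t: "s < t" "ereal t < limsup ratio" using ereal_dense2[OF assms(2)] by auto
  obtain d where d: "0 < d" "s * (1 + d) \<le> s + (t - s) / 4" using exponent_slack[OF assms(1) t(1)] by blast
  define e where "e = (t - s) / 4"
  have e: "0 < e" using t by (simp add: e_def)
  \<comment> \<open>A total below 1 makes the premeasure of every piece finite, and this finite
    bound drives the count of classes.\<close>
  have "packing_measure s A < 1" using assms(3) by simp
  then obtain F where F: "A \<subseteq> (\<Union>i. F i)" "(\<Sum>i. packing_premeasure s (F i)) < 1"
    unfolding packing_measure_def Inf_less_iff by auto
  have notin: "AE w in \<nu>. w \<notin> {w \<in> regular_words e d j. \<pi> w \<in> F i}" (is "AE w in \<nu>. w \<notin> ?S") for i j
  proof (rule AE_notin_if_small_covers)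
    fix b :: real assume "0 < b"
    have "packing_premeasure s (F i) \<le> (\<Sum>i. packing_premeasure s (F i))"
      using sum_le_suminf[of "\<lambda>i. packing_premeasure s (F i)" "{i}"] by simp
    also have "\<dots> < top" using F(2) by (rule order.strict_trans) simp
    finally obtain \<delta> where \<delta>: "0 < \<delta>"
        "(SUP B\<in>packings \<delta> (F i). \<Sum>\<^sub>\<infinity>(x, r)\<in>B. ennreal ((2 * r) powr s)) < top"
      unfolding packing_premeasure_def INF_less_iff by auto
    then obtain C where C: "0 \<le> C"
        "(SUP B\<in>packings \<delta> (F i). \<Sum>\<^sub>\<infinity>(x, r)\<in>B. ennreal ((2 * r) powr s)) = ennreal C"
      by (cases "SUP B\<in>packings \<delta> (F i). \<Sum>\<^sub>\<infinity>(x, r)\<in>B. ennreal ((2 * r) powr s)") auto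
    \<comment> \<open>The factor \<open>(3/2) powr s\<close> is what
      \<open>(2 * r) powr (- s)\<close> leaves over when \<open>r\<close> is a third of the
      separation radius.\<close>
    have "\<forall>\<^sub>F k in sequentially. C * (3/2) powr s * M k powr (- e) < b"
      using M_powr_tendsto_0[OF e] \<open>0 < b\<close> by (rule order_tendstoD)
    moreover have "\<forall>\<^sub>F k in sequentially. 1/3 * M k powr (- (1 + d)) < \<delta>"
      using d(1) \<delta>(1) by (intro order_tendstoD[OF M_powr_tendsto_0]) auto
    ultimately have "\<forall>\<^sub>F k in sequentially. C * (3/2) powr s * M k powr (- e) < b \<and>
        1/3 * M k powr (- (1 + d)) < \<delta> \<and> Suc j \<le> k"
      using eventually_ge_at_top by (intro eventually_conj)
    from frequently_ex[OF frequently_eventually_frequently[OF frequently_ratio_greater[OF t(2)] this]]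
    obtain k where k: "t < H k / ln (M k)" "C * (3/2) powr s * M k powr (- e) < b"
        "1/3 * M k powr (- (1 + d)) < \<delta>" "Suc j \<le> k"
      by auto
    define X where "X = key k ` ?S"
    have X: "finite X" unfolding X_def by (rule finite_subset[OF _ finite_keys[of k]]) (auto simp: regular_words_def)
    define rep where "rep = inv_into ?S (key k)"
    have rep: "rep x \<in> ?S" "key k (rep x) = x" if "x \<in> X" for x
      using that unfolding X_def rep_def by (rule inv_into_into, rule f_inv_into_f)
    \<comment> \<open>Centres from different classes are then at least \<open>3 * r\<close> apart,
      more than the \<open>2 * r\<close> that makes the closed balls disjoint.\<close>
    define r where "r = 1/3 * M k powr (- (1 + d))"
    have r: "0 < r" "r < \<delta>" using M_pos[of k] k(3) by (auto simp: r_def)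
    define B where "B = (\<lambda>x. (\<pi> (rep x), r)) ` X"
    have far: "3 * r \<le> dist (\<pi> (rep x)) (\<pi> (rep y))" if "x \<in> X" "y \<in> X" "x \<noteq> y" for x y
    proof (rule ccontr)
      assume "\<not> ?thesis"
      then have "dist (\<pi> (rep x)) (\<pi> (rep y)) < M k powr (- (1 + d))" by (simp add: r_def)
      then have "key k (rep y) = key k (rep x)"
        using rep(1)[OF that(1)] rep(1)[OF that(2)] k(4) by (simp add: regular_words_def)
      then show False using rep(2) that by simp
    qed
    have inj: "inj_on (\<lambda>x. (\<pi> (rep x), r)) X"
    proof (rule inj_onI, rule ccontr)
      fix x y assume "x \<in> X" "y \<in> X" "(\<pi> (rep x), r) = (\<pi> (rep y), r)" "x \<noteq> y"
      then show False using far[of x y] r(1) by simp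
    qed
    have "B \<in> packings \<delta> (F i)"
    proof -
      have "cball (\<pi> (rep x)) r \<inter> cball (\<pi> (rep y)) r = {}" if "x \<in> X" "y \<in> X" "x \<noteq> y" for x y
      proof -
        have "\<not> (dist (\<pi> (rep x)) z \<le> r \<and> dist (\<pi> (rep y)) z \<le> r)" for z
          using far[OF that] dist_triangle2[of "\<pi> (rep x)" "\<pi> (rep y)" z] r(1) by linarith
        then show ?thesis by (simp add: disjoint_iff)
      qed
      then have "disjoint_family_on (\<lambda>(x, r). cball x r) B"
        by (auto simp: disjoint_family_on_def B_def)
      moreover have "B \<subseteq> F i \<times> {0<..\<delta>}" using rep(1) r by (auto simp: B_def)
      ultimately show ?thesis using X by (simp add: packings_def B_def countable_finite)
    qed
    then have "(\<Sum>\<^sub>\<infinity>(x, r)\<in>B. ennreal ((2 * r) powr s)) \<le> ennreal C"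
      unfolding C(2)[symmetric] by (rule SUP_upper)
    moreover have "(\<Sum>\<^sub>\<infinity>(x, r)\<in>B. ennreal ((2 * r) powr s)) = ennreal (card X * (2 * r) powr s)"
      using X by (simp add: B_def sum.reindex[OF inj] ennreal_of_nat_eq_real_of_nat ennreal_mult)
    ultimately have "card X * (2 * r) powr s \<le> C" using C(1) by simp
    then have card: "card X \<le> C * (2 * r) powr (- s)"
      using r(1) by (simp add: powr_minus field_simps)
    have "prob (\<Union>x\<in>X. fibre k x) = (\<Sum>x\<in>X. prob (fibre k x))" by (rule prob_UN_fibre[OF X])
    also have "\<dots> \<le> card X * M k powr (- (t - e))"
    proof (rule sum_bounded_above)
      fix x assume x: "x \<in> X"
      have "t * ln (M k) \<le> H k" using k(1,4) ln_M_pos[of k] by (simp add: field_simps)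
      then show "prob (fibre k x) \<le> M k powr (- (t - e))"
        using fibre_mass_le[of k t "rep x" e d j] rep[OF x] k(4) by auto
    qed
    also have "\<dots> \<le> C * (2 * r) powr (- s) * M k powr (- (t - e))"
      by (intro mult_right_mono card) simp
    also have "(2 * r) powr (- s) = (3/2) powr s * M k powr (s * (1 + d))"
    proof -
      have "(2 * r) powr (- s) = (2/3 * M k powr (- (1 + d))) powr (- s)" by (simp add: r_def)
      also have "\<dots> = (2/3) powr (- s) * M k powr (s * (1 + d))"
        by (simp only: powr_mult powr_powr) (simp add: algebra_simps)
      also have "(2/3::real) powr (- s) = (3/2) powr s"
        by (simp add: powr_divide powr_minus field_simps)
      finally show ?thesis .
    qed
    also have "C * ((3/2) powr s * M k powr (s * (1 + d))) * M k powr (- (t - e))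
        = C * (3/2) powr s * M k powr (s * (1 + d) - (t - e))"
      by (simp add: powr_add[symmetric] algebra_simps)
    also have "\<dots> \<le> C * (3/2) powr s * M k powr (- e)"
      using d(2) t(1) C(1) M_ge_1[of k] by (intro mult_left_mono powr_mono) (auto simp: e_def field_simps)
    also have "\<dots> \<le> b" using k(2) by simp
    finally have "prob (\<Union>x\<in>X. fibre k x) \<le> b" .
    moreover have "?S \<subseteq> (\<Union>x\<in>X. fibre k x)" by (auto simp: X_def regular_words_def)
    moreover have "(\<Union>x\<in>X. fibre k x) \<in> events" using X by (intro sets.finite_UN sets_fibre)
    ultimately show "\<exists>U\<in>events. ?S \<subseteq> U \<and> prob U \<le> b" by blast
  qed
  have "AE w in \<nu>. \<forall>i j. w \<notin> {w \<in> regular_words e d j. \<pi> w \<in> F i}"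
    unfolding AE_all_countable by (intro allI notin)
  with AE_regular_words[OF e d(1)] show ?thesis
  proof eventually_elim
    case (elim w)
    show ?case
    proof
      assume "\<pi> w \<in> A"
      then obtain i where "\<pi> w \<in> F i" using F(1) by auto
      with elim show False by simp
    qed
  qed
qed

section \<open>The two dimension formulas for coded measures\<close>

lemma emeasure_distr_compl_eq_0_iff:
  assumes "A \<in> sets borel"
  shows "emeasure (distr \<nu> borel \<pi>) (space (distr \<nu> borel \<pi>) - A) = 0 \<longleftrightarrow> (AE w in \<nu>. \<pi> w \<in> A)"
proof -
  have "(AE w in \<nu>. \<pi> w \<in> A) \<longleftrightarrow> (AE x in distr \<nu> borel \<pi>. x \<in> A)"
    using assms by (subst AE_distr_iff) (auto simp: measurable_coding)
  also have "\<dots> \<longleftrightarrow> emeasure (distr \<nu> borel \<pi>) (space (distr \<nu> borel \<pi>) - A) = 0"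
    using assms by (subst AE_iff_measurable) auto
  finally show ?thesis by simp
qed

theorem hausdorff_dim_measure_eq: "hausdorff_dim_measure (distr \<nu> borel \<pi>) = liminf ratio"
proof (rule antisym)
  show "hausdorff_dim_measure (distr \<nu> borel \<pi>) \<le> liminf ratio"
  proof (rule dense_ge)
    fix z assume z: "liminf ratio < z"
    show "hausdorff_dim_measure (distr \<nu> borel \<pi>) \<le> z"
    proof (cases z)
      case (real s)
      obtain A where A: "A \<in> sets borel" "AE w in \<nu>. \<pi> w \<in> A" "hausdorff_measure s A = 0"
        by (rule hausdorff_null_carrier[OF z[unfolded real]])
      have "0 \<le> s" using order.strict_trans1[OF ratio_nonneg z] real by simp
      have "hausdorff_dim_measure (distr \<nu> borel \<pi>) \<le> hausdorff_dim A"
        unfolding hausdorff_dim_measure_def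
        using A(1) emeasure_distr_compl_eq_0_iff[OF A(1), THEN iffD2, OF A(2)]
        by (intro Inf_lower CollectI exI[of _ A] conjI refl) simp_all
      also have "\<dots> \<le> ereal s"
        unfolding hausdorff_dim_def using A(3) \<open>0 \<le> s\<close> by (intro Inf_lower) auto
      finally show ?thesis using real by simp
    qed (use z in auto)
  qed
  show "liminf ratio \<le> hausdorff_dim_measure (distr \<nu> borel \<pi>)"
    unfolding hausdorff_dim_measure_def hausdorff_dim_def
  proof (intro Inf_greatest, clarsimp, intro Inf_greatest, clarsimp)
    fix A s assume A: "A \<in> sets borel" "emeasure (distr \<nu> borel \<pi>) (UNIV - A) = 0"
      and s: "0 \<le> s" "hausdorff_measure s A = 0"
    show "liminf ratio \<le> ereal s"
    proof (rule ccontr)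
      assume "\<not> ?thesis"
      then have "AE w in \<nu>. \<pi> w \<notin> A"
        using hausdorff_null_AE_notin[OF s(1) _ s(2)] by (simp only: not_le)
      moreover have "AE w in \<nu>. \<pi> w \<in> A"
        using emeasure_distr_compl_eq_0_iff[OF A(1), THEN iffD1] A(2) by simp
      ultimately have "AE w in \<nu>. False" by eventually_elim simp
      then show False by simp
    qed
  qed
qed

theorem packing_dim_measure_eq: "packing_dim_measure (distr \<nu> borel \<pi>) = limsup ratio"
proof (rule antisym)
  show "packing_dim_measure (distr \<nu> borel \<pi>) \<le> limsup ratio"
  proof (rule dense_ge)
    fix z assume z: "limsup ratio < z"
    show "packing_dim_measure (distr \<nu> borel \<pi>) \<le> z"
    proof (cases z)
      case (real s)
      obtain A where A: "A \<in> sets borel" "AE w in \<nu>. \<pi> w \<in> A" "packing_measure s A = 0"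
        by (rule packing_null_carrier[OF z[unfolded real]])
      have "0 \<le> limsup ratio"
        using ratio_nonneg Liminf_le_Limsup[of sequentially ratio] by (simp add: order_trans)
      then have "0 \<le> s" using order.strict_trans1[OF _ z] real by fastforce
      have "packing_dim_measure (distr \<nu> borel \<pi>) \<le> packing_dim A"
        unfolding packing_dim_measure_def
        using A(1) emeasure_distr_compl_eq_0_iff[OF A(1), THEN iffD2, OF A(2)]
        by (intro Inf_lower CollectI exI[of _ A] conjI refl) simp_all
      also have "\<dots> \<le> ereal s"
        unfolding packing_dim_def using A(3) \<open>0 \<le> s\<close> by (intro Inf_lower) auto
      finally show ?thesis using real by simp
    qed (use z in auto)
  qed
  show "limsup ratio \<le> packing_dim_measure (distr \<nu> borel \<pi>)"
    unfolding packing_dim_measure_def packing_dim_def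
  proof (intro Inf_greatest, clarsimp, intro Inf_greatest, clarsimp)
    fix A s assume A: "A \<in> sets borel" "emeasure (distr \<nu> borel \<pi>) (UNIV - A) = 0"
      and s: "0 \<le> s" "packing_measure s A = 0"
    show "limsup ratio \<le> ereal s"
    proof (rule ccontr)
      assume "\<not> ?thesis"
      then have "AE w in \<nu>. \<pi> w \<notin> A"
        using packing_null_AE_notin[OF s(1) _ s(2)] by (simp only: not_le)
      moreover have "AE w in \<nu>. \<pi> w \<in> A"
        using emeasure_distr_compl_eq_0_iff[OF A(1), THEN iffD1] A(2) by simp
      ultimately have "AE w in \<nu>. False" by eventually_elim simp
      then show False by simp
    qed
  qed
qed

end

section \<open>Digit expansions in one variable\<close>

locale digit_expansion =
  fixes b :: "nat \<Rightarrow> nat"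
  assumes base_ge: "1 \<le> k \<Longrightarrow> 2 \<le> b k"
begin

definition base_prod :: "nat \<Rightarrow> real" where
  "base_prod k = (\<Prod>h=1..k. real (b h))"

definition digits :: "(nat \<Rightarrow> nat) \<Rightarrow> bool" where
  "digits d \<longleftrightarrow> (\<forall>k\<ge>1. d k < b k)"

text \<open>\<open>truncation d l\<close> and \<open>truncation d l + 1 / base_prod l\<close> are
  the end points of the closed interval of all numbers with an expansion beginning with the first
  \<open>l\<close> digits of \<open>d\<close>.\<close>

definition truncation :: "(nat \<Rightarrow> nat) \<Rightarrow> nat \<Rightarrow> real" where
  "truncation d l = (\<Sum>i=1..l. real (d i) / base_prod i)"

definition expansion :: "(nat \<Rightarrow> nat) \<Rightarrow> real" where
  "expansion d = (\<Sum>k. real (d (Suc k)) / base_prod (Suc k))"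

lemma base_prod_0 [simp]: "base_prod 0 = 1"
  by (simp add: base_prod_def)

lemma base_prod_Suc: "base_prod (Suc k) = base_prod k * real (b (Suc k))"
  by (simp add: base_prod_def)

lemma base_prod_ge: "2 ^ k \<le> base_prod k"
proof (induction k)
  case (Suc k)
  have "2 ^ k * (2::real) \<le> base_prod k * real (b (Suc k))"
    using Suc base_ge[of "Suc k"] by (intro mult_mono) (auto simp: base_prod_def intro!: prod_nonneg)
  then show ?case by (simp add: base_prod_Suc)
qed simp

lemma base_prod_pos: "0 < base_prod k"
  using base_prod_ge[of k] by (smt (verit) zero_less_power)

lemma base_prod_mono: "k \<le> l \<Longrightarrow> base_prod k \<le> base_prod l"
proof (induction l rule: dec_induct)
  case (step l)
  have "base_prod l * 1 \<le> base_prod l * real (b (Suc l))"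
    using base_ge[of "Suc l"] base_prod_pos[of l] by (intro mult_left_mono) auto
  then show ?case using step by (simp add: base_prod_Suc)
qed simp

lemma truncation_Suc: "truncation d (Suc l) = truncation d l + real (d (Suc l)) / base_prod (Suc l)"
  by (simp add: truncation_def)

lemma inverse_base_prod_Suc:
  "1 / base_prod l = 1 / base_prod (Suc l) + real (b (Suc l) - 1) / base_prod (Suc l)"
  using base_ge[of "Suc l"] base_prod_pos[of l]
  by (simp add: base_prod_Suc add_divide_distrib[symmetric] of_nat_diff)

lemma truncation_mono: "l \<le> L \<Longrightarrow> truncation d l \<le> truncation d L"
proof (induction L rule: dec_induct)
  case (step L)
  then show ?case using base_prod_pos[of "Suc L"] by (simp add: truncation_Suc add_increasing2)
qed simp

text \<open>Right end points of nested intervals decrease; by \<open>inverse_base_prod_Suc\<close>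
  the largest digit keeps the end point fixed.\<close>

lemma truncation_antimono:
  assumes "digits d"
  shows "l \<le> L \<Longrightarrow> truncation d L + 1 / base_prod L \<le> truncation d l + 1 / base_prod l"
proof (induction L rule: dec_induct)
  case (step L)
  have "d (Suc L) \<le> b (Suc L) - 1" using assms unfolding digits_def by (metis One_nat_def Suc_pred le_add1 less_Suc_eq_le plus_1_eq_Suc less_nat_zero_code not_gr_zero)
  then have "real (d (Suc L)) / base_prod (Suc L) \<le> real (b (Suc L) - 1) / base_prod (Suc L)"
    using base_prod_pos[of "Suc L"] by (intro divide_right_mono) auto
  with step show ?case by (simp add: truncation_Suc inverse_base_prod_Suc[of L])
qed simp

lemma sums_expansion:
  assumes "digits d"
  shows "(\<lambda>k. real (d (Suc k)) / base_prod (Suc k)) sums expansion d"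
proof -
  have "summable (\<lambda>k. real (d (Suc k)) / base_prod (Suc k))"
  proof (rule summableI_nonneg_bounded)
    fix n
    have "(\<Sum>k<n. real (d (Suc k)) / base_prod (Suc k)) = truncation d n"
      by (induction n) (simp_all add: truncation_Suc, simp add: truncation_def)
    also have "\<dots> \<le> 1"
      using truncation_antimono[OF assms, of 0 n] base_prod_pos[of n] by (simp add: truncation_def)
        (smt (verit) divide_pos_pos)
    finally show "(\<Sum>k<n. real (d (Suc k)) / base_prod (Suc k)) \<le> 1" .
  qed (use base_prod_pos in \<open>auto simp: less_imp_le\<close>)
  then show ?thesis by (simp add: expansion_def summable_sums)
qed

lemma truncation_tendsto:
  assumes "digits d"
  shows "truncation d \<longlonglongrightarrow> expansion d"
proof -
  have "truncation d = (\<lambda>n. \<Sum>k<n. real (d (Suc k)) / base_prod (Suc k))"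
  proof
    show "truncation d n = (\<Sum>k<n. real (d (Suc k)) / base_prod (Suc k))" for n
      by (induction n) (simp_all add: truncation_Suc, simp add: truncation_def)
  qed
  then show ?thesis using sums_expansion[OF assms] by (simp add: sums_def)
qed

lemma expansion_ge: "digits d \<Longrightarrow> truncation d l \<le> expansion d"
  by (rule LIMSEQ_le_const[OF truncation_tendsto]) (use truncation_mono in blast)+

lemma expansion_le: "digits d \<Longrightarrow> expansion d \<le> truncation d l + 1 / base_prod l"
proof (rule LIMSEQ_le_const2[OF truncation_tendsto])
  assume d: "digits d"
  have "truncation d L \<le> truncation d l + 1 / base_prod l" if "l \<le> L" for L
    using truncation_antimono[OF d that] base_prod_pos[of L] by (smt (verit) divide_pos_pos)
  then show "\<exists>L. \<forall>n\<ge>L. truncation d n \<le> truncation d l + 1 / base_prod l" by blast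
qed

text \<open>Only a run of zeros keeps the left end points together, so one nonzero digit keeps the
  level-\<open>t\<close> interval at least its own length away from the left end of the
  level-\<open>l\<close> interval.\<close>

lemma truncation_nonzero_digit:
  assumes "l < i" "i \<le> t" "d i \<noteq> 0"
  shows "truncation d l + 1 / base_prod t \<le> truncation d t"
proof -
  obtain h where h: "i = Suc h" "l \<le> h" using assms by (cases i) auto
  have "1 / base_prod t \<le> 1 / base_prod i"
    using base_prod_mono[OF assms(2)] base_prod_pos by (intro divide_left_mono) auto
  also have "\<dots> \<le> real (d i) / base_prod i"
    using assms(3) base_prod_pos[of i] by (intro divide_right_mono) auto
  finally show ?thesis
    using truncation_mono[OF h(2), of d] truncation_mono[OF assms(2), of d] h by (simp add: truncation_Suc)
qed

text \<open>Mirror image at the right end. Of the 2 in the numerator, one unit is the length of the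
  level-\<open>t\<close> interval and the other is the margin.\<close>

lemma truncation_nonmaximal_digit:
  assumes "digits d" "l < i" "i \<le> t" "d i \<noteq> b i - 1"
  shows "truncation d t + 2 / base_prod t \<le> truncation d l + 1 / base_prod l"
proof -
  obtain h where h: "i = Suc h" "l \<le> h" using assms by (cases i) auto
  have "1 / base_prod t \<le> 1 / base_prod i"
    using base_prod_mono[OF assms(3)] base_prod_pos by (intro divide_left_mono) auto
  have "d i + 1 \<le> b i - 1" using assms(1,4) h(1) by (auto simp: digits_def dest!: spec[of _ i])
  then have "real (d i + 1) / base_prod i \<le> real (b i - 1) / base_prod i"
    using base_prod_pos[of i] by (intro divide_right_mono) (auto simp del: of_nat_add)
  with h have "real (d i) / base_prod i + 2 / base_prod i \<le> 1 / base_prod h"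
    by (simp add: inverse_base_prod_Suc[of h] add_divide_distrib)
  then have "truncation d i + 2 / base_prod i \<le> truncation d h + 1 / base_prod h"
    using h by (simp add: truncation_Suc)
  moreover have "truncation d t + 1 / base_prod t \<le> truncation d i + 1 / base_prod i"
    by (rule truncation_antimono[OF assms(1,3)])
  moreover have "truncation d h + 1 / base_prod h \<le> truncation d l + 1 / base_prod l"
    by (rule truncation_antimono[OF assms(1) h(2)])
  ultimately show ?thesis using \<open>1 / base_prod t \<le> 1 / base_prod i\<close> by simp
qed

lemma truncation_first_difference:
  assumes "digits d" "1 \<le> i" "i \<le> l" "d i < d' i" "\<And>h. 1 \<le> h \<Longrightarrow> h < i \<Longrightarrow> d h = d' h"
  shows "truncation d l + 1 / base_prod l \<le> truncation d' l"
proof -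
  obtain h where h: "i = Suc h" using assms by (cases i) auto
  have eq: "truncation d h = truncation d' h"
    unfolding truncation_def using assms(5) h by (intro sum.cong) auto
  have "real (d i + 1) / base_prod i \<le> real (d' i) / base_prod i"
    using assms(4) base_prod_pos[of i] by (intro divide_right_mono) (auto simp del: of_nat_add)
  then have "truncation d i + 1 / base_prod i \<le> truncation d' i"
    using h eq by (simp add: truncation_Suc add_divide_distrib)
  with truncation_antimono[OF assms(1,3)] truncation_mono[OF assms(3), of d'] show ?thesis by linarith
qed

text \<open>Adjacent intervals share an end point, so closeness alone does not determine digits. The
  digits at \<open>i\<close> and \<open>j\<close> keep \<open>expansion d\<close> at distance at
  least \<open>1 / base_prod t\<close> from both ends of its level-\<open>l\<close> interval, and a
  number coded through another level-\<open>l\<close> interval lies beyond one of these ends. Only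
  \<open>d\<close> has to be away from the boundary.\<close>

lemma digits_eq_if_close:
  assumes d: "digits d" "digits d'"
    and i: "l < i" "i \<le> t" "d i \<noteq> 0" and j: "l < j" "j \<le> t" "d j \<noteq> b j - 1"
    and close: "\<bar>expansion d - expansion d'\<bar> < 1 / base_prod t"
  shows "\<forall>h\<in>{1..l}. d' h = d h"
proof (rule ccontr)
  assume "\<not> ?thesis"
  then have ex: "\<exists>h. 1 \<le> h \<and> h \<le> l \<and> d' h \<noteq> d h" by auto
  define h where "h = (LEAST h. 1 \<le> h \<and> h \<le> l \<and> d' h \<noteq> d h)"
  have h: "1 \<le> h" "h \<le> l" "d' h \<noteq> d h" using LeastI_ex[OF ex] by (auto simp: h_def)
  have eq: "d g = d' g" if "1 \<le> g" "g < h" for g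
    using not_less_Least[of g "\<lambda>h. 1 \<le> h \<and> h \<le> l \<and> d' h \<noteq> d h"] that h(2) by (auto simp: h_def)
  show False
  proof (cases "d h < d' h")
    case True
    have "truncation d l + 1 / base_prod l \<le> truncation d' l"
      by (rule truncation_first_difference[of d h l d']) (use d h eq True in auto)
    with truncation_nonmaximal_digit[OF d(1) j] expansion_le[OF d(1), of t] expansion_ge[OF d(2), of l] close
    show False by simp
  next
    case False
    have "truncation d' l + 1 / base_prod l \<le> truncation d l"
      by (rule truncation_first_difference[of d' h l d]) (use d h eq False in auto)
    with truncation_nonzero_digit[of l i t d, OF i] expansion_ge[OF d(1), of t] expansion_le[OF d(2), of l] close
    show False by linarith
  qed
qed

lemma expansion_close:
  assumes "digits d" "digits d'" "\<forall>h\<in>{1..l}. d h = d' h"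
  shows "\<bar>expansion d - expansion d'\<bar> \<le> 1 / base_prod l"
proof -
  have "truncation d l = truncation d' l"
    unfolding truncation_def using assms(3) by (intro sum.cong) auto
  then show ?thesis
    using expansion_ge[OF assms(1), of l] expansion_le[OF assms(1), of l]
      expansion_ge[OF assms(2), of l] expansion_le[OF assms(2), of l] by linarith
qed

end

section \<open>Concentration of the information of a word\<close>

lemma exp_le_quadratic: "exp y \<le> 1 + y + y\<^sup>2 * exp \<bar>y\<bar>" for y :: real
proof -
  obtain t where t: "\<bar>t\<bar> \<le> \<bar>y\<bar>" "exp y = (\<Sum>i<2. y ^ i / fact i) + exp t / fact 2 * y ^ 2"
    using Maclaurin_exp_le[of y 2] by blast
  have "exp t \<le> exp \<bar>y\<bar>" using t(1) by simp
  then have "exp t / 2 \<le> exp \<bar>y\<bar>" using exp_gt_zero[of "\<bar>y\<bar>"] by linarith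
  then have "exp t / 2 * y\<^sup>2 \<le> exp \<bar>y\<bar> * y\<^sup>2" by (intro mult_right_mono) auto
  then show ?thesis using t(2) by (simp add: numeral_2_eq_2 mult.commute)
qed

text \<open>The 8 is the reciprocal of the quadratic Taylor coefficient of
  \<open>exp (x / 2)\<close>. Half of the exponent is spent here so that the other half remains for
  \<open>exp \<bar>y\<bar>\<close> in \<open>information_mgf_le\<close>.\<close>

lemma square_le_exp_half: "0 \<le> x \<Longrightarrow> x\<^sup>2 \<le> 8 * exp (x / 2)" for x :: real
proof -
  assume "0 \<le> x"
  obtain t where t: "exp (x / 2) = (\<Sum>i<3. (x / 2) ^ i / fact i) + exp t / fact 3 * (x / 2) ^ 3"
    using Maclaurin_exp_le[of "x / 2" 3] by blast
  have "0 \<le> exp t / fact 3 * (x / 2) ^ 3" using \<open>0 \<le> x\<close> by simp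
  with t \<open>0 \<le> x\<close> show ?thesis by (simp add: numeral_3_eq_3 power2_eq_square fact_numeral)
qed

text \<open>The weight \<open>g\<close> may be much larger than \<open>p\<close>, and \<open>p\<close> may vanish: only
  \<open>p a * exp (- ln (g a)) \<le> 1\<close> enters.\<close>

lemma information_mgf_le:
  fixes p g :: "'a \<Rightarrow> real"
  assumes A: "finite A" "real (card A) \<le> B" and p: "\<And>a. a \<in> A \<Longrightarrow> 0 \<le> p a" "sum p A = 1"
    and g: "\<And>a. a \<in> A \<Longrightarrow> p a \<le> g a \<and> g a \<le> 1" and t: "\<bar>t\<bar> \<le> 1 / 2"
  defines "h \<equiv> \<Sum>a\<in>A. p a * - ln (g a)"
  shows "(\<Sum>a\<in>A. p a * exp (t * (- ln (g a) - h))) \<le> exp (B * (8 + B\<^sup>2) * exp (B / 2) * t\<^sup>2)"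
proof -
  let ?X = "\<lambda>a. - ln (g a)" and ?C = "(8 + B\<^sup>2) * exp (B / 2)"
  have X: "0 \<le> ?X a" "p a * exp (?X a) \<le> 1" if "a \<in> A" "0 < p a" for a
    using g[OF that(1)] that(2) by (auto simp: exp_minus field_simps)
  have pX: "0 \<le> p a * ?X a" "p a * ?X a \<le> 1" if "a \<in> A" for a
  proof -
    have "0 \<le> p a * ?X a \<and> p a * ?X a \<le> 1"
    proof (cases "p a = 0")
      case False
      then have "0 < p a" using p(1)[OF that] by simp
      have "p a * ?X a \<le> p a * exp (?X a)"
        using exp_ge_add_one_self[of "?X a"] \<open>0 < p a\<close> by (intro mult_left_mono) linarith+
      moreover have "0 \<le> p a * ?X a"
        using X(1)[OF that \<open>0 < p a\<close>] \<open>0 < p a\<close> by (intro mult_nonneg_nonneg) auto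
      ultimately show ?thesis using X(2)[OF that \<open>0 < p a\<close>] by linarith
    qed simp
    then show "0 \<le> p a * ?X a" "p a * ?X a \<le> 1" by auto
  qed
  \<comment> \<open>Each digit contributes at most 1 to the mean, so \<open>h\<close> is at most the
    number of digits.\<close>
  have h: "0 \<le> h" "h \<le> B"
    using sum_nonneg[of A "\<lambda>a. p a * ?X a"] sum_bounded_above[of A "\<lambda>a. p a * ?X a" 1] pX A
    by (auto simp: h_def)
  have "p a * exp (t * (?X a - h)) \<le> p a + t * (p a * ?X a - h * p a) + ?C * t\<^sup>2" if "a \<in> A" for a
  proof (cases "p a = 0")
    case True
    then show ?thesis by simp
  next
    case False
    then have "0 < p a" using p(1)[OF that] by simp
    note Xa = X[OF that this]
    define y where "y = t * (?X a - h)"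
    \<comment> \<open>Since \<open>t\<close> is at most 1/2 in absolute value,
      \<open>exp \<bar>y\<bar>\<close> uses only \<open>exp (?X a / 2)\<close>. With
      \<open>square_le_exp_half\<close> the remainder reaches exactly \<open>exp (?X a)\<close>,
      which the factor \<open>p a\<close> cancels.\<close>
    have "\<bar>y\<bar> \<le> 1 / 2 * (?X a + h)"
      unfolding y_def abs_mult using t Xa(1) h(1) by (intro mult_mono) auto
    then have e: "exp \<bar>y\<bar> \<le> exp (?X a / 2) * exp (B / 2)"
      using h(2) by (simp add: exp_add[symmetric])
    have "(?X a - h)\<^sup>2 \<le> (?X a)\<^sup>2 + h\<^sup>2"
      using mult_nonneg_nonneg[OF Xa(1) h(1)] by (simp add: power2_eq_square algebra_simps)
    also have "\<dots> \<le> 8 * exp (?X a / 2) + B\<^sup>2 * exp (?X a / 2)"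
    proof (rule add_mono[OF square_le_exp_half[OF Xa(1)]])
      have "h\<^sup>2 * 1 \<le> B\<^sup>2 * exp (?X a / 2)" using h Xa(1) by (intro mult_mono power_mono) auto
      then show "h\<^sup>2 \<le> B\<^sup>2 * exp (?X a / 2)" by simp
    qed
    finally have "y\<^sup>2 * exp \<bar>y\<bar> \<le> (t\<^sup>2 * (8 * exp (?X a / 2) + B\<^sup>2 * exp (?X a / 2))) * (exp (?X a / 2) * exp (B / 2))"
      unfolding y_def[symmetric] using e by (intro mult_mono) (auto simp: y_def power_mult_distrib intro!: mult_left_mono)
    also have "\<dots> = ?C * t\<^sup>2 * exp (?X a)"
      using exp_add[of "?X a / 2" "?X a / 2"] by (simp add: algebra_simps)
    finally have "exp y \<le> 1 + y + ?C * t\<^sup>2 * exp (?X a)" using exp_le_quadratic[of y] by linarith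
    then have "p a * exp y \<le> p a * (1 + y + ?C * t\<^sup>2 * exp (?X a))" using \<open>0 < p a\<close> by simp
    also have "\<dots> = p a + p a * y + ?C * t\<^sup>2 * (p a * exp (?X a))" by (simp add: algebra_simps)
    also have "\<dots> \<le> p a + p a * y + ?C * t\<^sup>2 * 1" using Xa(2) by (intro add_left_mono mult_left_mono) auto
    finally show ?thesis by (simp add: y_def algebra_simps)
  qed
  then have "(\<Sum>a\<in>A. p a * exp (t * (?X a - h))) \<le> (\<Sum>a\<in>A. p a + t * (p a * ?X a - h * p a) + ?C * t\<^sup>2)"
    by (rule sum_mono)
  also have "\<dots> = sum p A + t * ((\<Sum>a\<in>A. p a * ?X a) - h * sum p A) + card A * (?C * t\<^sup>2)"
    by (simp only: sum.distrib sum_subtractf sum_distrib_left[symmetric] sum_constant) simp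
  \<comment> \<open>The linear term vanishes because \<open>h\<close> is the mean.\<close>
  also have "\<dots> = 1 + card A * (?C * t\<^sup>2)" using p(2) by (simp add: h_def)
  also have "\<dots> \<le> 1 + B * (?C * t\<^sup>2)" using A(2) by (intro add_left_mono mult_right_mono) auto
  also have "\<dots> \<le> exp (B * (?C * t\<^sup>2))" by (rule exp_ge_add_one_self)
  finally show ?thesis by (simp add: mult.assoc)
qed

section \<open>The symbolic product measure and a Chernoff bound\<close>

locale moran_system =
  fixes n m :: "nat \<Rightarrow> nat" and D :: "nat \<Rightarrow> (nat \<times> nat) set"
    and p :: "nat \<Rightarrow> nat \<times> nat \<Rightarrow> real" and K :: nat
  assumes construction: "moran_construction n m D"
    and bases_le: "1 \<le> k \<Longrightarrow> n k \<le> K \<and> m k \<le> K"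
    and prob_vectors: "p \<in> moran_prob_vectors D"
begin

sublocale X: digit_expansion n
  using construction by unfold_locales (simp add: moran_construction_def)

sublocale Y: digit_expansion m
  using construction by unfold_locales (simp add: moran_construction_def)

abbreviation "\<nu> \<equiv> symbolic_measure D p"

text \<open>\<open>product_prob_space\<close> asks for a probability space at every index, also at
  0, where \<open>D\<close> and \<open>p\<close> are unconstrained; a one-point space fills that
  place.\<close>

definition digit_space :: "nat \<Rightarrow> (nat \<times> nat) measure" where
  "digit_space i = (if 1 \<le> i then point_measure (D i) (\<lambda>w. ennreal (p i w)) else count_space {undefined})"

lemma D_subset: "1 \<le> k \<Longrightarrow> D k \<subseteq> {0..<n k} \<times> {0..<m k}"
  using construction by (simp add: moran_construction_def)

lemma finite_D: "1 \<le> k \<Longrightarrow> finite (D k)"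
  using D_subset[of k] by (rule finite_subset) auto

lemma K_ge: "2 \<le> K"
  using X.base_ge[of 1] bases_le[of 1] by simp

lemma card_D_le: "1 \<le> k \<Longrightarrow> real (card (D k)) \<le> real (K * K)"
proof -
  assume k: "1 \<le> k"
  have "card (D k) \<le> card ({0..<n k} \<times> {0..<m k})" by (rule card_mono) (use D_subset[OF k] in auto)
  also have "\<dots> \<le> K * K" using bases_le[OF k] by (simp add: mult_mono)
  finally show ?thesis by (simp only: of_nat_le_iff)
qed

lemma p_nonneg: "1 \<le> k \<Longrightarrow> w \<in> D k \<Longrightarrow> 0 \<le> p k w"
  and sum_p: "1 \<le> k \<Longrightarrow> sum (p k) (D k) = 1"
  using prob_vectors by (auto simp: moran_prob_vectors_def prob_vector_on_def)

lemma symbolic_measure_eq: "\<nu> = PiM {1..} digit_space"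
  unfolding symbolic_measure_def by (rule PiM_cong) (auto simp: digit_space_def)

lemma prob_space_digit_space: "prob_space (digit_space i)"
proof (cases "1 \<le> i")
  case True
  have "(\<Sum>w\<in>D i. ennreal (p i w)) = 1"
    using sum_p[OF True] p_nonneg[OF True] by (simp add: sum_ennreal)
  then show ?thesis
    using True finite_D[OF True] by (auto simp: digit_space_def intro!: prob_space_point_measure)
qed (auto simp: digit_space_def intro!: prob_spaceI)

sublocale product_prob_space digit_space "{1..}"
  using prob_space_digit_space by (simp add: product_prob_space_def product_prob_space_axioms_def
      product_sigma_finite_def prob_space_imp_sigma_finite)

sublocale symbolic: prob_space \<nu>
  unfolding symbolic_measure_eq by (rule prob_space_PiM) (rule prob_space_digit_space)

lemma space_symbolic: "space \<nu> = (\<Pi>\<^sub>E i\<in>{1..}. D i)"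
  by (simp add: symbolic_measure_def space_PiM space_point_measure)

lemma symbolic_digit: "w \<in> space \<nu> \<Longrightarrow> 1 \<le> i \<Longrightarrow> w i \<in> D i"
  by (auto simp: space_symbolic)

lemma measurable_digit:
  fixes f :: "nat \<times> nat \<Rightarrow> 'b::topological_space"
  assumes "1 \<le> i"
  shows "(\<lambda>w. f (w i)) \<in> borel_measurable \<nu>"
proof -
  have "(\<lambda>w. w i) \<in> measurable \<nu> (digit_space i)"
    unfolding symbolic_measure_eq using assms by (intro measurable_component_singleton) simp
  moreover have "f \<in> borel_measurable (digit_space i)"
    using assms by (simp add: digit_space_def)
  ultimately show ?thesis by (rule measurable_compose)
qed

text \<open>Arbitrary digit sets are allowed at each level because the fibres of \<open>key\<close>
  use rows and columns, and the escape events use sets of boundary digits.\<close>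

lemma cylinder:
  assumes J: "finite J" "J \<subseteq> {1..}" and B: "\<And>i. i \<in> J \<Longrightarrow> B i \<subseteq> D i"
  shows "{w \<in> space \<nu>. \<forall>i\<in>J. w i \<in> B i} \<in> sets \<nu>"
    and "symbolic.prob {w \<in> space \<nu>. \<forall>i\<in>J. w i \<in> B i} = (\<Prod>i\<in>J. \<Sum>u\<in>B i. p i u)"
proof -
  have B': "B i \<in> sets (digit_space i)" if "i \<in> J" for i
    using B[OF that] J that by (auto simp: digit_space_def sets_point_measure)
  have eq: "{w \<in> space \<nu>. \<forall>i\<in>J. w i \<in> B i} = prod_emb {1..} digit_space J (Pi\<^sub>E J B)"
    using J by (auto simp: prod_emb_def symbolic_measure_eq space_PiM PiE_iff extensional_def)
  show "{w \<in> space \<nu>. \<forall>i\<in>J. w i \<in> B i} \<in> sets \<nu>"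
    unfolding eq unfolding symbolic_measure_eq using J B' by (intro sets_PiM_I) auto
  have B_nonneg: "0 \<le> (\<Sum>u\<in>B i. p i u)" if "i \<in> J" for i
    using J B[OF that] p_nonneg[of i] that by (intro sum_nonneg) auto
  have "emeasure \<nu> {w \<in> space \<nu>. \<forall>i\<in>J. w i \<in> B i} = (\<Prod>i\<in>J. emeasure (digit_space i) (B i))"
    unfolding eq unfolding symbolic_measure_eq using J B' by (intro emeasure_PiM_emb) auto
  also have "\<dots> = (\<Prod>i\<in>J. ennreal (\<Sum>u\<in>B i. p i u))"
  proof (rule prod.cong[OF refl])
    fix i assume i: "i \<in> J"
    then have "1 \<le> i" using J by auto
    have "(\<Sum>u\<in>B i. ennreal (p i u)) = ennreal (\<Sum>u\<in>B i. p i u)"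
      using B[OF i] p_nonneg[OF \<open>1 \<le> i\<close>] by (intro sum_ennreal) auto
    then show "emeasure (digit_space i) (B i) = ennreal (\<Sum>u\<in>B i. p i u)"
      using B[OF i] finite_D[OF \<open>1 \<le> i\<close>] \<open>1 \<le> i\<close> by (simp add: digit_space_def emeasure_point_measure_finite)
  qed
  also have "\<dots> = ennreal (\<Prod>i\<in>J. \<Sum>u\<in>B i. p i u)"
    using B_nonneg by (rule prod_ennreal)
  finally show "symbolic.prob {w \<in> space \<nu>. \<forall>i\<in>J. w i \<in> B i} = (\<Prod>i\<in>J. \<Sum>u\<in>B i. p i u)"
    using B_nonneg by (simp add: measure_def prod_nonneg)
qed

text \<open>The integrand sees only the coordinates in \<open>J\<close>, so the integral passes to
  the finite product, where it factorises.\<close>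

lemma nn_integral_prod_digits:
  assumes J: "finite J" "J \<subseteq> {1..}" and f: "\<And>i u. i \<in> J \<Longrightarrow> u \<in> D i \<Longrightarrow> 0 \<le> f i u"
  shows "(\<integral>\<^sup>+w. (\<Prod>i\<in>J. ennreal (f i (w i))) \<partial>\<nu>) = ennreal (\<Prod>i\<in>J. \<Sum>u\<in>D i. p i u * f i u)"
proof -
  have meas: "(\<lambda>u. ennreal (f i u)) \<in> borel_measurable (digit_space i)" if "i \<in> J" for i
    using J that by (auto simp: digit_space_def)
  have "(\<integral>\<^sup>+w. (\<Prod>i\<in>J. ennreal (f i (w i))) \<partial>\<nu>)
      = (\<integral>\<^sup>+w. (\<Prod>i\<in>J. ennreal (f i (restrict w J i))) \<partial>PiM {1..} digit_space)"
    by (simp add: symbolic_measure_eq cong: prod.cong)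
  also have "\<dots> = (\<integral>\<^sup>+w. (\<Prod>i\<in>J. ennreal (f i (w i))) \<partial>distr (PiM {1..} digit_space) (PiM J digit_space) (\<lambda>w. restrict w J))"
    using J meas by (intro nn_integral_distr[symmetric] measurable_restrict_subset borel_measurable_prod_ennreal)
      (auto intro!: measurable_compose[OF measurable_component_singleton])
  also have "\<dots> = (\<integral>\<^sup>+w. (\<Prod>i\<in>J. ennreal (f i (w i))) \<partial>PiM J digit_space)"
    by (simp only: distr_PiM_restrict_finite[OF J])
  also have "\<dots> = (\<Prod>i\<in>J. \<integral>\<^sup>+u. ennreal (f i u) \<partial>digit_space i)"
    using J meas by (intro product_nn_integral_prod) auto
  also have "\<dots> = (\<Prod>i\<in>J. ennreal (\<Sum>u\<in>D i. p i u * f i u))"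
  proof (rule prod.cong[OF refl])
    fix i assume i: "i \<in> J"
    then have "1 \<le> i" using J by auto
    then show "(\<integral>\<^sup>+u. ennreal (f i u) \<partial>digit_space i) = ennreal (\<Sum>u\<in>D i. p i u * f i u)"
      using finite_D p_nonneg f[OF i]
      by (simp add: digit_space_def nn_integral_point_measure_finite ennreal_mult[symmetric] sum_ennreal)
  qed
  also have "\<dots> = ennreal (\<Prod>i\<in>J. \<Sum>u\<in>D i. p i u * f i u)"
    using J p_nonneg f by (intro prod_ennreal sum_nonneg mult_nonneg_nonneg) auto
  finally show ?thesis .
qed

text \<open>The coefficient of \<open>t\<^sup>2\<close> in \<open>information_mgf_le\<close> for
  \<open>B = K * K\<close>, a bound for the number of digits of any level.\<close>

definition tail_constant :: real where
  "tail_constant = real (K * K) * (8 + (real (K * K))\<^sup>2) * exp (real (K * K) / 2)"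

lemma tail_constant_pos: "0 < tail_constant"
  using K_ge by (simp add: tail_constant_def add_pos_nonneg)

text \<open>Markov's inequality for \<open>exp (t * ?dev w)\<close>, whose integral factorises over
  the levels. The sign of \<open>t\<close> selects the upper or the lower tail.\<close>

lemma information_tail:
  assumes J: "finite J" "J \<subseteq> {1..}"
    and g: "\<And>i u. i \<in> J \<Longrightarrow> u \<in> D i \<Longrightarrow> p i u \<le> g i u \<and> g i u \<le> 1" and t: "\<bar>t\<bar> \<le> 1 / 2"
  shows "symbolic.prob {w \<in> space \<nu>. a \<le> t * ((\<Sum>i\<in>J. - ln (g i (w i))) - (\<Sum>i\<in>J. \<Sum>u\<in>D i. p i u * - ln (g i u)))}
      \<le> exp (tail_constant * t\<^sup>2 * card J - a)"
    (is "symbolic.prob {w \<in> space \<nu>. a \<le> t * ?dev w} \<le> _")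
proof -
  let ?h = "\<lambda>i. \<Sum>u\<in>D i. p i u * - ln (g i u)"
  let ?f = "\<lambda>i u. exp (t * (- ln (g i u) - ?h i))"
  have exp_dev: "exp (t * ?dev w) = (\<Prod>i\<in>J. ?f i (w i))" for w
    using J(1) by (simp only: exp_sum[symmetric] sum_distrib_left[symmetric] sum_subtractf)
  have meas: "(\<lambda>w. \<Prod>i\<in>J. ennreal (?f i (w i))) \<in> borel_measurable \<nu>"
  proof (rule borel_measurable_prod_ennreal)
    fix i assume "i \<in> J"
    then show "(\<lambda>w. ennreal (?f i (w i))) \<in> borel_measurable \<nu>"
      using J by (intro measurable_digit[of i "\<lambda>u. ennreal (?f i u)"]) auto
  qed
  have "{w \<in> space \<nu>. a \<le> t * ?dev w} = {w \<in> space \<nu>. 1 \<le> ennreal (exp (- a)) * (\<Prod>i\<in>J. ennreal (?f i (w i)))}"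
  proof (rule Collect_cong, rule conj_cong[OF refl])
    fix w
    have "ennreal (exp (- a)) * (\<Prod>i\<in>J. ennreal (?f i (w i))) = ennreal (exp (t * ?dev w - a))"
      unfolding exp_diff exp_dev
      by (simp add: prod_ennreal ennreal_mult[symmetric] prod_nonneg exp_minus field_simps)
    then show "(a \<le> t * ?dev w) = (1 \<le> ennreal (exp (- a)) * (\<Prod>i\<in>J. ennreal (?f i (w i))))"
      by simp
  qed
  then have "emeasure \<nu> {w \<in> space \<nu>. a \<le> t * ?dev w}
      \<le> ennreal (exp (- a)) * (\<integral>\<^sup>+w. (\<Prod>i\<in>J. ennreal (?f i (w i))) * indicator (space \<nu>) w \<partial>\<nu>)"
    using nn_integral_Markov_inequality[OF _ sets.top, of "\<lambda>w. \<Prod>i\<in>J. ennreal (?f i (w i))" \<nu> "ennreal (exp (- a))"] meas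
    by simp
  also have "(\<integral>\<^sup>+w. (\<Prod>i\<in>J. ennreal (?f i (w i))) * indicator (space \<nu>) w \<partial>\<nu>)
      = (\<integral>\<^sup>+w. (\<Prod>i\<in>J. ennreal (?f i (w i))) \<partial>\<nu>)"
    by (rule nn_integral_cong) simp
  also have "\<dots> = ennreal (\<Prod>i\<in>J. \<Sum>u\<in>D i. p i u * ?f i u)"
    by (rule nn_integral_prod_digits[OF J]) simp
  also have "\<dots> \<le> ennreal (exp (tail_constant * t\<^sup>2) ^ card J)"
  proof (rule ennreal_leI)
    have "(\<Prod>i\<in>J. \<Sum>u\<in>D i. p i u * ?f i u) \<le> (\<Prod>i\<in>J. exp (tail_constant * t\<^sup>2))"
    proof (rule prod_mono, rule conjI)
      fix i assume i: "i \<in> J"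
      then have "1 \<le> i" using J by auto
      show "0 \<le> (\<Sum>u\<in>D i. p i u * ?f i u)" using p_nonneg[OF \<open>1 \<le> i\<close>] by (intro sum_nonneg) simp
      show "(\<Sum>u\<in>D i. p i u * ?f i u) \<le> exp (tail_constant * t\<^sup>2)"
        unfolding tail_constant_def
        by (rule information_mgf_le[OF finite_D card_D_le p_nonneg sum_p g t]) (use i \<open>1 \<le> i\<close> in auto)
    qed
    then show "(\<Prod>i\<in>J. \<Sum>u\<in>D i. p i u * ?f i u) \<le> exp (tail_constant * t\<^sup>2) ^ card J" by simp
  qed
  also have "exp (tail_constant * t\<^sup>2) ^ card J = exp (tail_constant * t\<^sup>2 * card J)"
    by (simp add: exp_of_nat_mult[symmetric] mult.commute)
  finally have "emeasure \<nu> {w \<in> space \<nu>. a \<le> t * ?dev w}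
      \<le> ennreal (exp (- a)) * ennreal (exp (tail_constant * t\<^sup>2 * card J))"
    by (simp add: mult_left_mono)
  also have "\<dots> = ennreal (exp (tail_constant * t\<^sup>2 * card J - a))"
    by (simp add: ennreal_mult[symmetric] exp_add[symmetric])
  finally show ?thesis by (simp add: symbolic.emeasure_eq_measure)
qed


end

section \<open>Approximate squares and their entropy\<close>

context moran_system
begin

definition level :: "nat \<Rightarrow> nat" where
  "level k = approx_level n m k"

definition depth :: "nat \<Rightarrow> nat" where
  "depth k = max (level k) k"

text \<open>Replacing digit \<open>i\<close> within this set leaves the key unchanged. It is a
  single digit, a column, a row or all of \<open>D i\<close>, according to which coordinates the key
  still records, so one formula covers both orders of \<open>level k\<close> and
  \<open>k\<close>.\<close>

definition digit_class :: "nat \<Rightarrow> nat \<Rightarrow> nat \<times> nat \<Rightarrow> (nat \<times> nat) set" where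
  "digit_class k i u = {v \<in> D i. (i \<le> level k \<longrightarrow> fst v = fst u) \<and> (i \<le> k \<longrightarrow> snd v = snd u)}"

definition class_prob :: "nat \<Rightarrow> nat \<Rightarrow> nat \<times> nat \<Rightarrow> real" where
  "class_prob k i u = (\<Sum>v\<in>digit_class k i u. p i v)"

definition key :: "nat \<Rightarrow> (nat \<Rightarrow> nat \<times> nat) \<Rightarrow> (nat \<Rightarrow> nat) \<times> (nat \<Rightarrow> nat)" where
  "key k w = (restrict (\<lambda>i. fst (w i)) {1..level k}, restrict (\<lambda>i. snd (w i)) {1..k})"

abbreviation "entropy_k \<equiv> moran_entropy n m D p"

text \<open>Justifies the definite description in \<open>approx_level\<close>: the least
  \<open>l\<close> whose product of \<open>n\<close> reaches that of \<open>m\<close> qualifies, and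
  monotone products leave no other. The condition on \<open>k\<close> makes
  \<open>Y.base_prod k\<close> exceed 1, which keeps \<open>l\<close> away from 0.\<close>

lemma level_spec:
  assumes "1 \<le> k"
  shows "1 \<le> level k" "Y.base_prod k \<le> X.base_prod (level k)" "X.base_prod (level k - 1) < Y.base_prod k"
proof -
  let ?Q = "\<lambda>l. 1 \<le> l \<and> 1 / X.base_prod l \<le> 1 / Y.base_prod k \<and> 1 / Y.base_prod k < 1 / X.base_prod (l - 1)"
  have Q: "?Q l \<longleftrightarrow> 1 \<le> l \<and> Y.base_prod k \<le> X.base_prod l \<and> X.base_prod (l - 1) < Y.base_prod k" for l
    using X.base_prod_pos[of l] X.base_prod_pos[of "l - 1"] Y.base_prod_pos[of k] by (simp add: field_simps)
  have "1 < Y.base_prod k"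
    using Y.base_prod_ge[of k] one_less_power[of "2::real" k] assms by linarith
  have ex: "\<exists>l. Y.base_prod k \<le> X.base_prod l"
    using real_arch_pow[of 2 "Y.base_prod k"] X.base_prod_ge by (metis less_le_not_le linear numeral_One one_less_numeral_iff order_trans semiring_norm(76))
  define l where "l = (LEAST l. Y.base_prod k \<le> X.base_prod l)"
  have l: "Y.base_prod k \<le> X.base_prod l" unfolding l_def by (rule LeastI_ex[OF ex])
  have "l \<noteq> 0" using l \<open>1 < Y.base_prod k\<close> by (auto intro: ccontr)
  then have "X.base_prod (l - 1) < Y.base_prod k"
    using not_less_Least[of "l - 1" "\<lambda>l. Y.base_prod k \<le> X.base_prod l"] by (simp add: l_def)
  then have "?Q l" using l \<open>l \<noteq> 0\<close> unfolding Q by simp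
  moreover have "l' = l" if "?Q l'" for l'
  proof (rule ccontr)
    assume "l' \<noteq> l"
    then consider "l' \<le> l - 1" | "l \<le> l' - 1" by linarith
    then show False
    proof cases
      case 1
      then show False using X.base_prod_mono[OF 1] that[unfolded Q] \<open>?Q l\<close>[unfolded Q] by linarith
    next
      case 2
      then show False using X.base_prod_mono[OF 2] that[unfolded Q] \<open>?Q l\<close>[unfolded Q] by linarith
    qed
  qed
  ultimately have "?Q (THE l. ?Q l)" by (rule theI)
  then have "?Q (level k)" by (simp only: level_def approx_level_def X.base_prod_def Y.base_prod_def)
  then show "1 \<le> level k" "Y.base_prod k \<le> X.base_prod (level k)" "X.base_prod (level k - 1) < Y.base_prod k"
    using Q by auto
qed

text \<open>This also covers \<open>k = 0\<close>, where the definite description in \<^const>\<open>approx_level\<close> is unspecified.\<close>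

lemma base_prod_level_ge: "Y.base_prod k \<le> X.base_prod (level k)"
proof (cases "1 \<le> k")
  case False
  then have "k = 0" by simp
  then show ?thesis
    using order_trans[OF one_le_power[of "2::real" "level k"] X.base_prod_ge[of "level k"]] by simp
qed (rule level_spec)

lemma base_prod_add_le:
  assumes "\<And>i. 1 \<le> i \<Longrightarrow> 2 \<le> b i \<and> b i \<le> K"
  shows "(\<Prod>h=1..a + s. real (b h)) \<le> (\<Prod>h=1..a. real (b h)) * real K ^ s"
proof (induction s)
  case (Suc s)
  have "(\<Prod>h=1..a + Suc s. real (b h)) = (\<Prod>h=1..a + s. real (b h)) * real (b (Suc (a + s)))" by simp
  also have "\<dots> \<le> ((\<Prod>h=1..a. real (b h)) * real K ^ s) * real K"
    using Suc assms[of "Suc (a + s)"] by (intro mult_mono) (auto intro!: mult_nonneg_nonneg prod_nonneg)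
  finally show ?case by (simp add: mult_ac)
qed simp

lemma X_base_prod_add_le: "X.base_prod (a + s) \<le> X.base_prod a * real K ^ s"
  unfolding X.base_prod_def by (rule base_prod_add_le) (use X.base_ge bases_le in auto)

lemma Y_base_prod_add_le: "Y.base_prod (a + s) \<le> Y.base_prod a * real K ^ s"
  unfolding Y.base_prod_def by (rule base_prod_add_le) (use Y.base_ge bases_le in auto)

text \<open>Compares \<open>2 ^ (level k - 1)\<close> with \<open>K ^ k\<close>, hence with
  \<open>2 ^ (K * k)\<close>. Only linearity in \<open>k\<close> matters: it keeps the Chernoff
  exponent and the position of the escape windows of order \<open>k\<close>.\<close>

lemma level_le: "1 \<le> k \<Longrightarrow> level k \<le> K * k"
proof -
  assume k: "1 \<le> k"
  have "2 ^ (level k - 1) \<le> X.base_prod (level k - 1)" by (rule X.base_prod_ge)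
  also have "\<dots> < Y.base_prod k" using level_spec[OF k] by simp
  also have "\<dots> \<le> real K ^ k" using Y_base_prod_add_le[of 0 k] by simp
  also have "\<dots> \<le> (2 ^ K) ^ k"
  proof (rule power_mono)
    show "real K \<le> 2 ^ K" using less_exp[of K] by (metis less_imp_le of_nat_le_iff of_nat_numeral of_nat_power)
  qed simp
  finally have "(2::real) ^ (level k - 1) < 2 ^ (K * k)" by (simp add: power_mult)
  then show ?thesis by simp
qed

lemma depth_le: "1 \<le> k \<Longrightarrow> depth k \<le> K * k"
proof -
  assume k: "1 \<le> k"
  have "1 * k \<le> K * k" using K_ge by (intro mult_right_mono) auto
  then show ?thesis using level_le[OF k] by (simp add: depth_def)
qed

lemma key_eq_iff:
  "key k v = key k w \<longleftrightarrow> (\<forall>i\<in>{1..level k}. fst (v i) = fst (w i)) \<and> (\<forall>i\<in>{1..k}. snd (v i) = snd (w i))"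
  unfolding key_def prod.inject restrict_def fun_eq_iff by auto

lemma digit_class_subset: "digit_class k i u \<subseteq> D i"
  by (auto simp: digit_class_def)

lemma class_prob_bounds:
  assumes "1 \<le> i" "u \<in> D i"
  shows "p i u \<le> class_prob k i u \<and> class_prob k i u \<le> 1"
proof
  show "p i u \<le> class_prob k i u"
    unfolding class_prob_def using assms p_nonneg finite_D[OF assms(1)]
    by (intro member_le_sum) (auto simp: digit_class_def)
  have "class_prob k i u \<le> sum (p i) (D i)"
    unfolding class_prob_def using assms p_nonneg finite_D[OF assms(1)] digit_class_subset by (intro sum_mono2) auto
  then show "class_prob k i u \<le> 1" using sum_p[OF assms(1)] by simp
qed

lemma fibre_eq:
  assumes "w \<in> space \<nu>"
  shows "{v \<in> space \<nu>. key k v = key k w} = {v \<in> space \<nu>. \<forall>i\<in>{1..depth k}. v i \<in> digit_class k i (w i)}"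
  unfolding key_eq_iff by (auto simp: digit_class_def depth_def symbolic_digit)

lemma prob_fibre:
  assumes "w \<in> space \<nu>"
  shows "symbolic.prob {v \<in> space \<nu>. key k v = key k w} = (\<Prod>i\<in>{1..depth k}. class_prob k i (w i))"
  unfolding fibre_eq[OF assms] class_prob_def by (rule cylinder) (auto intro: subsetD[OF digit_class_subset])

lemma key_fibre_in_sets: "{w \<in> space \<nu>. key k w = x} \<in> sets \<nu>"
proof (cases "\<exists>w\<in>space \<nu>. key k w = x")
  case True
  then obtain w where "w \<in> space \<nu>" "x = key k w" by blast
  show ?thesis
    unfolding \<open>x = key k w\<close> fibre_eq[OF \<open>w \<in> space \<nu>\<close>]
    by (rule cylinder) (auto intro: subsetD[OF digit_class_subset])
next
  case False
  then have "{w \<in> space \<nu>. key k w = x} = {}" by auto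
  then show ?thesis by (simp only: sets.empty_sets)
qed

lemma finite_key_image: "finite (key k ` space \<nu>)"
proof (rule finite_subset)
  show "key k ` space \<nu> \<subseteq> (\<Pi>\<^sub>E i\<in>{1..level k}. fst ` D i) \<times> (\<Pi>\<^sub>E i\<in>{1..k}. snd ` D i)"
    by (auto simp: key_def symbolic_digit)
  show "finite ((\<Pi>\<^sub>E i\<in>{1..level k}. fst ` D i) \<times> (\<Pi>\<^sub>E i\<in>{1..k}. snd ` D i))"
    by (intro finite_cartesian_product finite_PiE finite_imageI finite_D) auto
qed

lemma row_prob_eq: "(\<Sum>v\<in>{v \<in> D i. snd v = j}. p i v) = row_prob D p i j"
  unfolding row_prob_def
  by (rule sum.reindex_bij_witness[of _ "\<lambda>a. (a, j)" fst]) auto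

lemma col_prob_eq: "(\<Sum>v\<in>{v \<in> D i. fst v = j}. p i v) = col_prob D p i j"
  unfolding col_prob_def
  by (rule sum.reindex_bij_witness[of _ "\<lambda>a. (j, a)" snd]) auto

lemma class_prob_eq:
  assumes "1 \<le> i" "i \<le> depth k" "u \<in> D i"
  shows "class_prob k i u = (if i \<le> level k then if i \<le> k then p i u else col_prob D p i (fst u)
     else row_prob D p i (snd u))"
proof -
  have "digit_class k i u = (if i \<le> level k then if i \<le> k then {u} else {v \<in> D i. fst v = fst u}
      else {v \<in> D i. snd v = snd u})"
    using assms by (auto simp: digit_class_def depth_def prod_eq_iff)
  then show ?thesis using row_prob_eq[where i = i and j = "snd u"] col_prob_eq[where i = i and j = "fst u"] by (simp add: class_prob_def)
qed

text \<open>Identifies the entropy as the mean of \<open>information k\<close>: the two branches of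
  its definition become the same sum over \<open>depth k\<close> levels.\<close>

lemma entropy_eq: "entropy_k k = (\<Sum>i\<in>{1..depth k}. \<Sum>u\<in>D i. p i u * - ln (class_prob k i u))"
proof (cases "level k \<le> k")
  case True
  have split: "{1..depth k} = {1..level k} \<union> {level k + 1..k}" using True by (auto simp: depth_def)
  have "(\<Sum>i\<in>{1..depth k}. \<Sum>u\<in>D i. p i u * - ln (class_prob k i u))
      = (\<Sum>i\<in>{1..level k}. \<Sum>u\<in>D i. p i u * - ln (class_prob k i u))
        + (\<Sum>i\<in>{level k + 1..k}. \<Sum>u\<in>D i. p i u * - ln (class_prob k i u))"
    unfolding split by (rule sum.union_disjoint) auto
  also have "\<dots> = (\<Sum>i\<in>{1..level k}. \<Sum>u\<in>D i. p i u * - ln (p i u))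
        + (\<Sum>i\<in>{level k + 1..k}. \<Sum>u\<in>D i. p i u * - ln (row_prob D p i (snd u)))"
    using True by (intro arg_cong2[of _ _ _ _ "(+)"] sum.cong refl) (auto simp: class_prob_eq depth_def)
  finally show ?thesis using True
    by (simp add: moran_entropy_def Let_def level_def sum_negf)
next
  case False
  have split: "{1..depth k} = {1..k} \<union> {k + 1..level k}" using False by (auto simp: depth_def)
  have "(\<Sum>i\<in>{1..depth k}. \<Sum>u\<in>D i. p i u * - ln (class_prob k i u))
      = (\<Sum>i\<in>{1..k}. \<Sum>u\<in>D i. p i u * - ln (class_prob k i u))
        + (\<Sum>i\<in>{k + 1..level k}. \<Sum>u\<in>D i. p i u * - ln (class_prob k i u))"
    unfolding split by (rule sum.union_disjoint) auto
  also have "\<dots> = (\<Sum>i\<in>{1..k}. \<Sum>u\<in>D i. p i u * - ln (p i u))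
        + (\<Sum>i\<in>{k + 1..level k}. \<Sum>u\<in>D i. p i u * - ln (col_prob D p i (fst u)))"
    using False by (intro arg_cong2[of _ _ _ _ "(+)"] sum.cong refl) (auto simp: class_prob_eq depth_def)
  finally show ?thesis using False
    by (simp add: moran_entropy_def Let_def level_def sum_negf)
qed

lemma entropy_nonneg: "0 \<le> entropy_k k"
  unfolding entropy_eq
proof (intro sum_nonneg)
  fix i u assume "i \<in> {1..depth k}" and u: "u \<in> D i"
  then have i: "1 \<le> i" by simp
  show "0 \<le> p i u * - ln (class_prob k i u)"
  proof (cases "p i u = 0")
    case False
    then have "0 < class_prob k i u" "class_prob k i u \<le> 1"
      using class_prob_bounds[OF i u, of k] p_nonneg[OF i u] by auto
    then show ?thesis using p_nonneg[OF i u] by (intro mult_nonneg_nonneg) auto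
  qed simp
qed

section \<open>Almost sure mass of approximate squares\<close>

text \<open>With \<open>ln 0 = 0\<close> a class of probability 0 would break the identity between
  its mass and \<open>exp (- information k w)\<close>; almost every word avoids such digits.\<close>

lemma AE_digits_positive: "AE w in \<nu>. \<forall>i\<ge>1. 0 < p i (w i)"
proof -
  have "AE w in \<nu>. 1 \<le> i \<longrightarrow> 0 < p i (w i)" for i
  proof (cases "1 \<le> i")
    case True
    let ?B = "\<lambda>i. {u \<in> D i. p i u = 0}"
    have "{w \<in> space \<nu>. \<forall>j\<in>{i}. w j \<in> ?B j} \<in> sets \<nu>"
      "symbolic.prob {w \<in> space \<nu>. \<forall>j\<in>{i}. w j \<in> ?B j} = (\<Prod>j\<in>{i}. \<Sum>u\<in>?B j. p j u)"
      using cylinder[of "{i}" ?B] True by auto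
    then have "{w \<in> space \<nu>. \<forall>j\<in>{i}. w j \<in> ?B j} \<in> null_sets \<nu>"
      by (auto simp: null_sets_def symbolic.emeasure_eq_measure)
    then have "AE w in \<nu>. w \<notin> {w \<in> space \<nu>. \<forall>j\<in>{i}. w j \<in> ?B j}" by (rule AE_not_in)
    then show ?thesis
      using AE_space
    proof eventually_elim
      case (elim w)
      then have "w i \<in> D i" "p i (w i) \<noteq> 0" using symbolic_digit[OF elim(2) True] by auto
      then show ?case using p_nonneg[OF True, of "w i"] by simp
    qed
  qed simp
  then show ?thesis unfolding AE_all_countable by blast
qed

lemma AE_eventually_notin:
  assumes A: "\<And>k. A k \<in> sets \<nu>" and q: "0 \<le> q" "q < 1"
    and le: "\<And>k. 1 \<le> k \<Longrightarrow> symbolic.prob (A k) \<le> C * q ^ k"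
  shows "AE w in \<nu>. \<forall>\<^sub>F k in sequentially. w \<notin> A k"
proof -
  have "summable (\<lambda>k. symbolic.prob (A k))"
  proof (rule summable_comparison_test)
    show "\<exists>N. \<forall>k\<ge>N. norm (symbolic.prob (A k)) \<le> C * q ^ k"
      using le by (intro exI[of _ 1]) auto
    show "summable (\<lambda>k. C * q ^ k)" using q by (intro summable_mult summable_geometric) simp
  qed
  then have "AE w in \<nu>. \<forall>\<^sub>F k in sequentially. w \<in> space \<nu> - A k"
    by (intro borel_cantelli_AE1 A) (auto simp: symbolic.emeasure_eq_measure)
  then show ?thesis by eventually_elim (auto elim: eventually_mono)
qed

definition information :: "nat \<Rightarrow> (nat \<Rightarrow> nat \<times> nat) \<Rightarrow> real" where
  "information k w = (\<Sum>i\<in>{1..depth k}. - ln (class_prob k i (w i)))"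

lemma information_measurable: "information k \<in> borel_measurable \<nu>"
  unfolding information_def[abs_def]
proof (rule borel_measurable_sum)
  fix i assume "i \<in> {1..depth k}"
  then show "(\<lambda>w. - ln (class_prob k i (w i))) \<in> borel_measurable \<nu>"
    by (intro measurable_digit[of i "\<lambda>u. - ln (class_prob k i u)"]) simp
qed

lemma AE_information_one_sided:
  assumes "0 < e" "\<bar>\<sigma>\<bar> = 1"
  shows "AE w in \<nu>. \<forall>\<^sub>F k in sequentially. \<sigma> * (information k w - entropy_k k) < e * real k"
proof -
  \<comment> \<open>The second-order cost is at most
    \<open>tail_constant * t\<^sup>2 * K * k\<close>. This \<open>t\<close> makes it at most half of
    the gain \<open>t * e * k\<close>, so the tail is geometric in \<open>k\<close>; the bound 1/2
    is the range of \<open>information_tail\<close>.\<close>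
  define t where "t = min (1 / 2) (e / (2 * (tail_constant * real K)))"
  have t: "0 < t" "t \<le> 1 / 2" "t * (tail_constant * real K) \<le> e / 2"
  proof -
    have c: "0 < tail_constant * real K" using tail_constant_pos K_ge by simp
    then have "0 < e / (2 * (tail_constant * real K))" using assms(1) by (intro divide_pos_pos) simp_all
    then show "0 < t" "t \<le> 1 / 2" by (simp_all only: t_def min_less_iff_conj min.cobounded1) simp
    have "t \<le> e / (2 * (tail_constant * real K))" by (simp only: t_def min.cobounded2)
    then have "t * (2 * (tail_constant * real K)) \<le> e" using c by (subst (asm) pos_le_divide_eq) auto
    then show "t * (tail_constant * real K) \<le> e / 2" by simp
  qed
  let ?A = "\<lambda>k. {w \<in> space \<nu>. t * (e * real k) \<le> (\<sigma> * t) * (information k w - entropy_k k)}"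
  have "AE w in \<nu>. \<forall>\<^sub>F k in sequentially. w \<notin> ?A k"
  proof (rule AE_eventually_notin)
    show "?A k \<in> sets \<nu>" for k
      using information_measurable[of k] by measurable
    show "0 \<le> exp (- (t * e / 2))" "exp (- (t * e / 2)) < 1" using t assms by auto
    fix k :: nat assume k: "1 \<le> k"
    have "symbolic.prob (?A k) \<le> exp (tail_constant * (\<sigma> * t)\<^sup>2 * card {1..depth k} - t * (e * real k))"
      unfolding information_def entropy_eq
      by (rule information_tail) (use class_prob_bounds t assms(2) in \<open>auto simp: abs_mult\<close>)
    also have "\<dots> \<le> exp (- (t * e / 2) * real k)"
    proof (subst exp_le_cancel_iff)
      have "\<sigma>\<^sup>2 = 1" using assms(2) by (metis one_power2 power2_abs)
      then have "tail_constant * (\<sigma> * t)\<^sup>2 * card {1..depth k} = tail_constant * t\<^sup>2 * real (depth k)"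
        by (simp add: power_mult_distrib)
      also have "\<dots> \<le> tail_constant * t\<^sup>2 * (real K * real k)"
        using depth_le[OF k] tail_constant_pos by (intro mult_left_mono) (auto simp: of_nat_mult[symmetric] simp del: of_nat_mult)
      also have "\<dots> = t * (tail_constant * real K) * (t * real k)" by (simp add: power2_eq_square)
      also have "\<dots> \<le> e / 2 * (t * real k)" using t by (intro mult_right_mono) auto
      finally show "tail_constant * (\<sigma> * t)\<^sup>2 * card {1..depth k} - t * (e * real k) \<le> - (t * e / 2) * real k"
        by (simp add: algebra_simps)
    qed
    also have "\<dots> = 1 * exp (- (t * e / 2)) ^ k" by (simp add: exp_of_nat2_mult[symmetric])
    finally show "symbolic.prob (?A k) \<le> 1 * exp (- (t * e / 2)) ^ k" .
  qed
  then show ?thesis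
    using AE_space
  proof eventually_elim
    case (elim w)
    from elim(1) show ?case
    proof eventually_elim
      case (elim k)
      with \<open>w \<in> space \<nu>\<close> have "t * (\<sigma> * (information k w - entropy_k k)) < t * (e * real k)"
        by (simp add: not_le mult_ac)
      then show ?case using t(1) by simp
    qed
  qed
qed

lemma ln_base_prod_ge: "real k * ln 2 \<le> ln (Y.base_prod k)"
proof -
  have "ln (2 ^ k) \<le> ln (Y.base_prod k)" using Y.base_prod_ge[of k] Y.base_prod_pos[of k] by (subst ln_le_cancel_iff) auto
  then show ?thesis by (simp add: ln_realpow)
qed

lemma AE_fibre_mass:
  assumes "0 < e"
  shows "AE w in \<nu>. \<forall>\<^sub>F k in sequentially.
    Y.base_prod k powr (- e) * exp (- entropy_k k) \<le> symbolic.prob {v \<in> space \<nu>. key k v = key k w} \<and>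
    symbolic.prob {v \<in> space \<nu>. key k v = key k w} \<le> Y.base_prod k powr e * exp (- entropy_k k)"
proof -
  \<comment> \<open>\<open>ln_base_prod_ge\<close> turns an error of \<open>e * ln 2 * k\<close> in
    the exponent into the factor \<open>Y.base_prod k powr e\<close>.\<close>
  have "0 < e * ln 2" using assms by simp
  from AE_information_one_sided[OF this abs_one] AE_information_one_sided[OF this, of "- 1", simplified]
    AE_digits_positive AE_space
  show ?thesis
  proof (eventually_elim, simp)
    fix w
    assume w: "w \<in> space \<nu>" "\<forall>i\<ge>Suc 0. 0 < p i (w i)"
      and ev: "\<forall>\<^sub>F k in sequentially. information k w - entropy_k k < e * ln 2 * real k"
        "\<forall>\<^sub>F k in sequentially. entropy_k k - information k w < e * ln 2 * real k"
    from ev show "\<forall>\<^sub>F k in sequentially.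
        Y.base_prod k powr (- e) * exp (- entropy_k k) \<le> symbolic.prob {v \<in> space \<nu>. key k v = key k w} \<and>
        symbolic.prob {v \<in> space \<nu>. key k v = key k w} \<le> Y.base_prod k powr e * exp (- entropy_k k)"
    proof eventually_elim
      case (elim k)
      have pos: "0 < class_prob k i (w i)" if "i \<in> {1..depth k}" for i
        using class_prob_bounds[OF _ symbolic_digit[OF w(1)], of i k] w(2) that by force
      have "exp (- information k w) = (\<Prod>i\<in>{1..depth k}. exp (ln (class_prob k i (w i))))"
        by (simp add: information_def exp_sum sum_negf)
      also have "\<dots> = (\<Prod>i\<in>{1..depth k}. class_prob k i (w i))"
        by (intro prod.cong refl exp_ln pos)
      finally have mass: "symbolic.prob {v \<in> space \<nu>. key k v = key k w} = exp (- information k w)"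
        by (simp add: prob_fibre[OF w(1)])
      have "e * ln 2 * real k \<le> e * ln (Y.base_prod k)"
        using mult_left_mono[OF ln_base_prod_ge[of k], of e] assms by (simp add: mult_ac)
      then show ?case
        unfolding mass using elim Y.base_prod_pos[of k] by (simp add: powr_def exp_add[symmetric])
    qed
  qed
qed

end

section \<open>Separation\<close>

text \<open>If no level of the window were centred, the counting function would agree at both ends.
  It equals \<open>b * N\<close> up to an error that is a small multiple of \<open>N\<close>,
  whereas the window has length proportional to \<open>k\<close> and starts at a level of order
  \<open>k\<close>.\<close>

lemma frequency_separation_gap:
  fixes a :: "nat \<Rightarrow> nat" and c K :: real
  assumes "frequency_separation n m D" "0 < c" "0 \<le> K" and a: "\<And>k. 1 \<le> k \<Longrightarrow> real (a k) \<le> K * real k"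
  shows "\<forall>\<^sub>F k in sequentially. \<exists>i. a k < i \<and> i \<le> a k + nat \<lfloor>c * real k\<rfloor> \<and> centred n m D i"
proof -
  define f where "f N = card {k \<in> {1..N}. centred n m D k}" for N
  obtain b where b: "0 < b" "(\<lambda>N. real (f N) / real N) \<longlonglongrightarrow> b"
    using assms(1) by (auto simp: frequency_separation_def f_def)
  \<comment> \<open>The errors at the two ends add up to at most \<eta> times
    \<open>(2 * K + c) * k\<close>, up to constants; this choice makes that half of the expected
    increase \<open>b * c * k\<close>.\<close>
  define \<eta> where "\<eta> = b * c / (2 * (2 * K + c))"
  have "0 < 2 * K + c" using assms(2,3) by simp
  then have \<eta>: "0 < \<eta>" "\<eta> * (2 * K + c) = b * c / 2"
    unfolding \<eta>_def using b(1) assms(2) by (simp, simp only: times_divide_eq_left) (simp add: field_simps)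
  obtain N0 where N0: "\<And>N. N0 \<le> N \<Longrightarrow> \<bar>real (f N) / real N - b\<bar> < \<eta>"
    using LIMSEQ_D[OF b(2) \<eta>(1)] by auto
  \<comment> \<open>Absorbs the finitely many \<open>N\<close> below \<open>N0\<close>, so that
    \<open>approx\<close> holds for every \<open>N\<close>, also when \<open>a k\<close> stays
    small.\<close>
  define A where "A = (1 + b) * real N0"
  have A: "0 \<le> A" using b by (simp add: A_def)
  have f_le: "f N \<le> N" for N
  proof -
    have "card {k \<in> {1..N}. centred n m D k} \<le> card {1..N}" by (rule card_mono) auto
    then show ?thesis by (simp add: f_def)
  qed
  have approx: "\<bar>real (f N) - b * real N\<bar> \<le> \<eta> * real N + A" for N
  proof (cases "N = 0 \<or> N < N0")
    case True
    have "N \<le> N0" "real (f N) \<le> real N0" using True f_le[of N] by auto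
    then have "b * real N \<le> b * real N0" using b by simp
    moreover have "0 \<le> b * real N" "0 \<le> \<eta> * real N" "0 \<le> b * real N0" using b \<eta> by auto
    ultimately show ?thesis using \<open>real (f N) \<le> real N0\<close> by (simp add: A_def distrib_right)
  next
    case False
    then have "\<bar>real (f N) / real N - b\<bar> * real N \<le> \<eta> * real N"
      using N0[of N] by (intro mult_right_mono) auto
    also have "\<bar>real (f N) / real N - b\<bar> * real N = \<bar>(real (f N) / real N - b) * real N\<bar>"
      by (simp add: abs_mult)
    also have "(real (f N) / real N - b) * real N = real (f N) - b * real N"
      using False by (simp add: left_diff_distrib)
    finally show ?thesis using A by linarith
  qed
  have "\<forall>\<^sub>F k in sequentially. 1 \<le> k \<and> b + 2 * A < b * c / 2 * real k"
  proof (rule eventually_conj[OF eventually_ge_at_top])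
    have "0 < b * c / 2" using b assms(2) by simp
    then show "\<forall>\<^sub>F k in sequentially. b + 2 * A < b * c / 2 * real k" by real_asymp
  qed
  then show ?thesis
  proof eventually_elim
    case (elim k)
    define t where "t = nat \<lfloor>c * real k\<rfloor>"
    have "0 \<le> c * real k" using assms(2) by simp
    then have t: "real t \<le> c * real k" "c * real k - 1 \<le> real t" by (auto simp: t_def)
    show ?case
    proof (rule ccontr)
      assume "\<not> ?case"
      then have none: "\<not> centred n m D i" if "a k < i" "i \<le> a k + t" for i using that by (auto simp: t_def)
      have "{i \<in> {1..a k + t}. centred n m D i} = {i \<in> {1..a k}. centred n m D i}"
        using none by (force simp: not_less[symmetric])
      then have "f (a k + t) = f (a k)" by (simp add: f_def)
      with approx[of "a k + t"] approx[of "a k"]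
      have "b * real t \<le> \<eta> * (2 * real (a k) + real t) + 2 * A" by (simp add: algebra_simps)
      also have "\<dots> \<le> \<eta> * (2 * (K * real k) + c * real k) + 2 * A"
        using a[of k] elim t \<eta> by (intro add_right_mono mult_left_mono add_mono) auto
      also have "\<dots> = (\<eta> * (2 * K + c)) * real k + 2 * A" by (simp add: algebra_simps)
      finally have "b * real t \<le> b * c / 2 * real k + 2 * A" by (simp only: \<eta>(2))
      moreover have "b * (c * real k - 1) \<le> b * real t" using t b by (intro mult_left_mono) auto
      ultimately show False using elim by (simp add: algebra_simps)
    qed
  qed
qed

section \<open>The coding map and the separation of approximate squares\<close>

context moran_system
begin

abbreviation coding :: "(nat \<Rightarrow> nat \<times> nat) \<Rightarrow> real \<times> real" where
  "coding \<equiv> coding_map n m"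

lemma digits_of_word:
  assumes "w \<in> space \<nu>"
  shows "X.digits (\<lambda>i. fst (w i))" "Y.digits (\<lambda>i. snd (w i))"
  using symbolic_digit[OF assms] D_subset by (force simp: X.digits_def Y.digits_def)+

lemma coding_eq:
  assumes "w \<in> space \<nu>"
  shows "coding w = (X.expansion (\<lambda>i. fst (w i)), Y.expansion (\<lambda>i. snd (w i)))"
proof -
  have "(\<lambda>k. (real (fst (w (Suc k))) / X.base_prod (Suc k), real (snd (w (Suc k))) / Y.base_prod (Suc k)))
      sums (X.expansion (\<lambda>i. fst (w i)), Y.expansion (\<lambda>i. snd (w i)))"
    using tendsto_Pair[OF X.sums_expansion[OF digits_of_word(1)[OF assms], unfolded sums_def]
        Y.sums_expansion[OF digits_of_word(2)[OF assms], unfolded sums_def]]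
    by (simp add: sums_def sum_prod)
  then show ?thesis by (simp add: coding_map_def X.base_prod_def Y.base_prod_def sums_iff)
qed

lemma coding_measurable: "coding \<in> borel_measurable \<nu>"
  unfolding coding_map_def[abs_def]
proof (rule borel_measurable_suminf)
  fix k
  show "(\<lambda>w. (real (fst (w (Suc k))) / (\<Prod>h=1..Suc k. real (n h)),
      real (snd (w (Suc k))) / (\<Prod>h=1..Suc k. real (m h)))) \<in> borel_measurable \<nu>"
    by (rule measurable_digit[of "Suc k" "\<lambda>u. (real (fst u) / (\<Prod>h=1..Suc k. real (n h)),
      real (snd u) / (\<Prod>h=1..Suc k. real (m h)))"]) simp
qed

text \<open>\<open>B i\<close> will be the digits on one side of the unit square. Under FSC the
  escape is deterministic, since \<open>B i\<close> is empty at a centred level; under MSC staying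
  in \<open>B\<close> throughout the window has probability geometric in \<open>k\<close> by
  independence.\<close>

lemma AE_escape:
  fixes a :: "nat \<Rightarrow> nat"
  assumes B: "\<And>i. 1 \<le> i \<Longrightarrow> B i \<subseteq> D i" and a: "\<And>k. 1 \<le> k \<Longrightarrow> a k \<le> K * k" and c: "0 < c"
    and sep: "frequency_separation n m D \<and> (\<forall>i\<ge>1. centred n m D i \<longrightarrow> B i = {}) \<or>
      (\<exists>C. 0 < C \<and> C < 1 \<and> (\<forall>i\<ge>1. (\<Sum>u\<in>B i. p i u) \<le> C))"
  shows "AE w in \<nu>. \<forall>\<^sub>F k in sequentially. \<exists>i. a k < i \<and> i \<le> a k + nat \<lfloor>c * real k\<rfloor> \<and> w i \<notin> B i"
  using sep
proof
  assume sep: "frequency_separation n m D \<and> (\<forall>i\<ge>1. centred n m D i \<longrightarrow> B i = {})"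
  have "real (a k) \<le> real K * real k" if "1 \<le> k" for k
    using a[OF that] by (simp add: of_nat_mult[symmetric] del: of_nat_mult)
  then have "\<forall>\<^sub>F k in sequentially. \<exists>i. a k < i \<and> i \<le> a k + nat \<lfloor>c * real k\<rfloor> \<and> centred n m D i"
    using sep c by (intro frequency_separation_gap[where K = "real K"]) auto
  then have "\<forall>\<^sub>F k in sequentially. \<exists>i. a k < i \<and> i \<le> a k + nat \<lfloor>c * real k\<rfloor> \<and> w i \<notin> B i" for w
  proof eventually_elim
    case (elim k)
    then obtain i where i: "a k < i" "i \<le> a k + nat \<lfloor>c * real k\<rfloor>" "centred n m D i" by blast
    then have "B i = {}" using sep by auto
    with i show ?case by blast
  qed
  then show ?thesis by simp
next
  assume "\<exists>C. 0 < C \<and> C < 1 \<and> (\<forall>i\<ge>1. (\<Sum>u\<in>B i. p i u) \<le> C)"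
  then obtain C where C: "0 < C" "C < 1" "\<And>i. 1 \<le> i \<Longrightarrow> (\<Sum>u\<in>B i. p i u) \<le> C" by auto
  let ?J = "\<lambda>k. {a k<..a k + nat \<lfloor>c * real k\<rfloor>}"
  let ?A = "\<lambda>k. {w \<in> space \<nu>. \<forall>i\<in>?J k. w i \<in> B i}"
  have "AE w in \<nu>. \<forall>\<^sub>F k in sequentially. w \<notin> ?A k"
  proof (rule AE_eventually_notin)
    show "?A k \<in> sets \<nu>" for k by (rule cylinder) (use B in auto)
    show "0 \<le> C powr c" "C powr c < 1" using powr_less_mono2[of c C 1] C c by auto
    fix k :: nat assume "1 \<le> k"
    have "symbolic.prob (?A k) = (\<Prod>i\<in>?J k. \<Sum>u\<in>B i. p i u)" by (rule cylinder) (use B in auto)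
    also have "\<dots> \<le> (\<Prod>i\<in>?J k. C)"
    proof (rule prod_mono, rule conjI)
      fix i assume "i \<in> ?J k"
      then have i: "1 \<le> i" by simp
      show "0 \<le> (\<Sum>u\<in>B i. p i u)" using B[OF i] p_nonneg[OF i] by (intro sum_nonneg) auto
      show "(\<Sum>u\<in>B i. p i u) \<le> C" by (rule C(3)[OF i])
    qed
    also have "\<dots> = C powr real (nat \<lfloor>c * real k\<rfloor>)" using C by (simp add: powr_realpow)
    \<comment> \<open>The floor loses at most one level, hence the factor
      \<open>1 / C\<close>.\<close>
    also have "\<dots> \<le> C powr (c * real k - 1)"
      using C c by (intro powr_mono') (auto simp: of_nat_nat)
    also have "\<dots> = 1 / C * (C powr c) ^ k"
      using C by (simp add: powr_diff powr_powr powr_realpow[symmetric])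
    finally show "symbolic.prob (?A k) \<le> 1 / C * (C powr c) ^ k" .
  qed
  then show ?thesis
    using AE_space
  proof eventually_elim
    case (elim w)
    from elim(1) show ?case
    proof eventually_elim
      case (elim k)
      then show ?case using \<open>w \<in> space \<nu>\<close> by auto
    qed
  qed
qed

text \<open>A window of \<open>t\<close> levels costs at most \<open>K ^ t\<close>, about half of
  the allowance \<open>Y.base_prod k powr \<delta>\<close>. One further factor \<open>K\<close> is
  needed because \<open>level_spec\<close> bounds \<open>X.base_prod\<close> from above only at
  \<open>level k - 1\<close>; the condition on \<open>k\<close> pays for it from the other
  half.\<close>

lemma separation_thresholds:
  assumes "0 < \<delta>" "1 \<le> k" "2 * ln (real K) \<le> \<delta> * ln 2 * real k"
    and t: "t = nat \<lfloor>\<delta> * ln 2 / (2 * ln (real K)) * real k\<rfloor>"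
  shows "Y.base_prod k powr (- (1 + \<delta>)) \<le> 1 / X.base_prod (level k + t)"
    and "Y.base_prod k powr (- (1 + \<delta>)) \<le> 1 / Y.base_prod (k + t)"
proof -
  have lnK: "0 < ln (real K)" using K_ge by simp
  have M: "0 < Y.base_prod k" by (rule Y.base_prod_pos)
  have "real t \<le> \<delta> * ln 2 / (2 * ln (real K)) * real k"
    unfolding t using assms(1) lnK by simp
  then have "real t * ln (real K) \<le> (\<delta> * ln 2 / (2 * ln (real K)) * real k) * ln (real K)"
    using lnK by (intro mult_right_mono) auto
  also have "\<dots> = \<delta> * ln 2 * real k / 2" using lnK by simp
  finally have "real (Suc t) * ln (real K) \<le> \<delta> * (real k * ln 2)" using assms(3) by (simp add: algebra_simps)
  also have "\<dots> \<le> \<delta> * ln (Y.base_prod k)" using ln_base_prod_ge assms(1) by (intro mult_left_mono) auto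
  finally have "exp (real (Suc t) * ln (real K)) \<le> exp (\<delta> * ln (Y.base_prod k))" by simp
  then have pow: "real K ^ Suc t \<le> Y.base_prod k powr \<delta>"
    using K_ge M by (simp only: exp_of_nat_mult powr_def) (simp add: powr_def)
  have *: "Y.base_prod k powr (- (1 + \<delta>)) \<le> 1 / P"
    if P: "0 < P" "P \<le> Y.base_prod k * real K ^ Suc t" for P
  proof -
    have "P \<le> Y.base_prod k * Y.base_prod k powr \<delta>"
      using P(2) mult_left_mono[OF pow, of "Y.base_prod k"] M by linarith
    also have "\<dots> = Y.base_prod k powr (1 + \<delta>)" using M by (simp add: powr_add)
    finally have "1 / Y.base_prod k powr (1 + \<delta>) \<le> 1 / P"
      using P(1) M by (intro divide_left_mono) auto
    then show ?thesis by (simp only: powr_minus_divide)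
  qed
  have "X.base_prod (level k + t) = X.base_prod (level k - 1 + Suc t)" using level_spec(1)[OF assms(2)] by simp
  also have "\<dots> \<le> X.base_prod (level k - 1) * real K ^ Suc t" by (rule X_base_prod_add_le)
  also have "\<dots> \<le> Y.base_prod k * real K ^ Suc t"
    using level_spec(3)[OF assms(2)] by (intro mult_right_mono) auto
  finally show "Y.base_prod k powr (- (1 + \<delta>)) \<le> 1 / X.base_prod (level k + t)"
    by (rule *[OF X.base_prod_pos])
  have "Y.base_prod (k + t) \<le> Y.base_prod (k + Suc t)" by (rule Y.base_prod_mono) simp
  also have "\<dots> \<le> Y.base_prod k * real K ^ Suc t" by (rule Y_base_prod_add_le)
  finally show "Y.base_prod k powr (- (1 + \<delta>)) \<le> 1 / Y.base_prod (k + t)"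
    by (rule *[OF Y.base_prod_pos])
qed

lemma AE_separation:
  assumes sep: "frequency_separation n m D \<or> measure_separation n m D p" and \<delta>: "0 < \<delta>"
  shows "AE w in \<nu>. \<forall>\<^sub>F k in sequentially. \<forall>v\<in>space \<nu>.
    dist (coding w) (coding v) < Y.base_prod k powr (- (1 + \<delta>)) \<longrightarrow> key k v = key k w"
proof -
  define c where "c = \<delta> * ln 2 / (2 * ln (real K))"
  have c: "0 < c" using \<delta> K_ge by (simp add: c_def)
  let ?L = "\<lambda>i. {u \<in> D i. fst u = 0}" and ?R = "\<lambda>i. {u \<in> D i. fst u = n i - 1}"
    and ?B = "\<lambda>i. {u \<in> D i. snd u = 0}" and ?T = "\<lambda>i. {u \<in> D i. snd u = m i - 1}"
  \<comment> \<open>Brings both separation conditions into the form required by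
    \<open>AE_escape\<close>, uniformly for the four sides: FSC empties each side at centred levels,
    and MSC bounds its probability, a row or column sum, by \<open>C\<close>.\<close>
  have edges: "frequency_separation n m D \<and> (\<forall>i\<ge>1. centred n m D i \<longrightarrow> S i = {}) \<or>
      (\<exists>C. 0 < C \<and> C < 1 \<and> (\<forall>i\<ge>1. (\<Sum>u\<in>S i. p i u) \<le> C))"
    if S: "S \<in> {?L, ?R, ?B, ?T}" for S
    using sep
  proof
    assume "frequency_separation n m D"
    moreover have "S i = {}" if "centred n m D i" for i
      using S that by (auto simp: centred_def)
    ultimately show ?thesis by blast
  next
    assume "measure_separation n m D p"
    then obtain C where C: "0 < C" "C < 1"
      "\<And>k. 1 \<le> k \<Longrightarrow> row_prob D p k 0 < C \<and> row_prob D p k (m k - 1) < C \<and>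
         col_prob D p k 0 < C \<and> col_prob D p k (n k - 1) < C"
      by (auto simp: measure_separation_def)
    have "(\<Sum>u\<in>S i. p i u) \<le> C" if i: "1 \<le> i" for i
    proof -
      have "(\<Sum>u\<in>S i. p i u) \<in> {row_prob D p i 0, row_prob D p i (m i - 1), col_prob D p i 0, col_prob D p i (n i - 1)}"
        using S by (elim insertE emptyE) (simp_all add: row_prob_eq[symmetric] col_prob_eq[symmetric])
      with C(3)[OF i] show ?thesis by (elim insertE emptyE) simp_all
    qed
    with C(1,2) show ?thesis by blast
  qed
  have id_le: "k \<le> K * k" for k using K_ge by simp
  have "AE w in \<nu>. \<forall>\<^sub>F k in sequentially. \<exists>i. level k < i \<and> i \<le> level k + nat \<lfloor>c * real k\<rfloor> \<and> w i \<notin> ?L i"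
    by (rule AE_escape[OF _ level_le c edges]) (simp_all add: Collect_subset)
  moreover have "AE w in \<nu>. \<forall>\<^sub>F k in sequentially. \<exists>i. level k < i \<and> i \<le> level k + nat \<lfloor>c * real k\<rfloor> \<and> w i \<notin> ?R i"
    by (rule AE_escape[OF _ level_le c edges]) (simp_all add: Collect_subset)
  moreover have "AE w in \<nu>. \<forall>\<^sub>F k in sequentially. \<exists>i. k < i \<and> i \<le> k + nat \<lfloor>c * real k\<rfloor> \<and> w i \<notin> ?B i"
    by (rule AE_escape[OF _ id_le c edges]) (simp_all add: Collect_subset)
  moreover have "AE w in \<nu>. \<forall>\<^sub>F k in sequentially. \<exists>i. k < i \<and> i \<le> k + nat \<lfloor>c * real k\<rfloor> \<and> w i \<notin> ?T i"
    by (rule AE_escape[OF _ id_le c edges]) (simp_all add: Collect_subset)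
  ultimately show ?thesis
    using AE_space
  proof eventually_elim
    case (elim w)
    note w = elim(5)
    have "0 < \<delta> * ln 2" using \<delta> by simp
    then have "\<forall>\<^sub>F k in sequentially. 2 * ln (real K) \<le> \<delta> * ln 2 * real k" by real_asymp
    from elim(1-4) this eventually_ge_at_top[of 1] show ?case
    proof eventually_elim
      case (elim k)
      define t where "t = nat \<lfloor>c * real k\<rfloor>"
      note thr = separation_thresholds[OF \<delta> elim(6,5) t_def[unfolded c_def]]
      show ?case
      proof (intro ballI impI)
        fix v assume v: "v \<in> space \<nu>"
          and close: "dist (coding w) (coding v) < Y.base_prod k powr (- (1 + \<delta>))"
        from elim(1)[folded t_def] obtain i1 where i1: "level k < i1" "i1 \<le> level k + t" and "w i1 \<notin> ?L i1" by blast
        then have i1': "fst (w i1) \<noteq> 0" using symbolic_digit[OF w, of i1] by simp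
        from elim(2)[folded t_def] obtain i2 where i2: "level k < i2" "i2 \<le> level k + t" and "w i2 \<notin> ?R i2" by blast
        then have i2': "fst (w i2) \<noteq> n i2 - 1" using symbolic_digit[OF w, of i2] by simp
        from elim(3)[folded t_def] obtain i3 where i3: "k < i3" "i3 \<le> k + t" and "w i3 \<notin> ?B i3" by blast
        then have i3': "snd (w i3) \<noteq> 0" using symbolic_digit[OF w, of i3] by simp
        from elim(4)[folded t_def] obtain i4 where i4: "k < i4" "i4 \<le> k + t" and "w i4 \<notin> ?T i4" by blast
        then have i4': "snd (w i4) \<noteq> m i4 - 1" using symbolic_digit[OF w, of i4] by simp
        have "\<bar>X.expansion (\<lambda>i. fst (w i)) - X.expansion (\<lambda>i. fst (v i))\<bar> \<le> dist (coding w) (coding v)"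
          using dist_fst_le[of "coding w" "coding v"] by (simp add: coding_eq w v dist_real_def)
        with close thr(1) have "\<forall>i\<in>{1..level k}. fst (v i) = fst (w i)"
          by (intro X.digits_eq_if_close[OF digits_of_word(1)[OF w] digits_of_word(1)[OF v] i1 i1' i2 i2']) linarith
        moreover have "\<bar>Y.expansion (\<lambda>i. snd (w i)) - Y.expansion (\<lambda>i. snd (v i))\<bar> \<le> dist (coding w) (coding v)"
          using dist_snd_le[of "coding w" "coding v"] by (simp add: coding_eq w v dist_real_def)
        with close thr(2) have "\<forall>i\<in>{1..k}. snd (v i) = snd (w i)"
          by (intro Y.digits_eq_if_close[OF digits_of_word(2)[OF w] digits_of_word(2)[OF v] i3 i3' i4 i4']) linarith
        ultimately show "key k v = key k w" by (simp add: key_eq_iff)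
      qed
    qed
  qed
qed

text \<open>By the choice of \<open>level k\<close> the width of an approximate square does not
  exceed its height \<open>1 / Y.base_prod k\<close>; the 2 comes from bounding the Euclidean norm
  by the sum of the coordinates.\<close>

lemma dist_coding_le:
  assumes "v \<in> space \<nu>" "w \<in> space \<nu>" "key k v = key k w"
  shows "dist (coding v) (coding w) \<le> 2 / Y.base_prod k"
proof -
  have "\<bar>X.expansion (\<lambda>i. fst (v i)) - X.expansion (\<lambda>i. fst (w i))\<bar> \<le> 1 / X.base_prod (level k)"
    using assms(3)[unfolded key_eq_iff] by (intro X.expansion_close digits_of_word assms(1,2)) simp
  also have "\<dots> \<le> 1 / Y.base_prod k"
    using base_prod_level_ge[of k] Y.base_prod_pos[of k] by (intro divide_left_mono) (auto simp: X.base_prod_pos)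
  moreover have "\<bar>Y.expansion (\<lambda>i. snd (v i)) - Y.expansion (\<lambda>i. snd (w i))\<bar> \<le> 1 / Y.base_prod k"
    using assms(3)[unfolded key_eq_iff] by (intro Y.expansion_close digits_of_word assms(1,2)) simp
  ultimately show ?thesis
    using norm_Pair_le[of "X.expansion (\<lambda>i. fst (v i)) - X.expansion (\<lambda>i. fst (w i))"
        "Y.expansion (\<lambda>i. snd (v i)) - Y.expansion (\<lambda>i. snd (w i))"]
    by (simp add: coding_eq assms dist_norm)
qed

lemma coded_measure:
  assumes "frequency_separation n m D \<or> measure_separation n m D p"
  shows "coded_measure \<nu> coding key Y.base_prod entropy_k 2 (real K)"
proof (intro coded_measure.intro coded_measure_axioms.intro)
  show "prob_space \<nu>" by (rule symbolic.prob_space_axioms)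
  show "Y.base_prod (Suc k) \<le> real K * Y.base_prod k" for k
    using Y_base_prod_add_le[of k 1] by (simp add: mult.commute)
qed (fact coding_measurable finite_key_image key_fibre_in_sets Y.base_prod_ge entropy_nonneg
    dist_coding_le AE_fibre_mass AE_separation[OF assms] zero_less_numeral)+

end

theorem theorem2p2:
  fixes n m :: "nat \<Rightarrow> nat"
    and D :: "nat \<Rightarrow> (nat \<times> nat) set"
    and E :: "(real \<times> real) set"
    and p :: "nat \<Rightarrow> nat \<times> nat \<Rightarrow> real"
  assumes "moran_construction n m D"
    and "E = moran_set n m D"
    and "bdd_above (n ` {1..} \<union> m ` {1..})"
    and "p \<in> moran_prob_vectors D"
    and "frequency_separation n m D \<or> measure_separation n m D p"
  shows "hausdorff_dim_measure (moran_measure n m D p) =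
           liminf (\<lambda>k. ereal (moran_entropy n m D p k / (\<Sum>i=1..k. ln (real (m i)))))
       \<and> packing_dim_measure (moran_measure n m D p) =
           limsup (\<lambda>k. ereal (moran_entropy n m D p k / (\<Sum>i=1..k. ln (real (m i)))))"
proof -
  obtain K where K: "\<And>x. x \<in> n ` {1..} \<union> m ` {1..} \<Longrightarrow> x \<le> K"
    using assms(3) by (auto simp: bdd_above_def)
  interpret moran_system n m D p K
  proof
    show "n k \<le> K \<and> m k \<le> K" if "1 \<le> k" for k using K[of "n k"] K[of "m k"] that by simp
  qed (fact assms(1,4))+
  interpret coded: coded_measure \<nu> coding key Y.base_prod entropy_k 2 "real K"
    by (rule coded_measure[OF assms(5)])
  have ln_eq: "(\<Sum>i=1..k. ln (real (m i))) = ln (Y.base_prod k)" for k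
    unfolding Y.base_prod_def
  proof (rule ln_prod[symmetric])
    fix i assume "i \<in> {1..k}"
    then show "real (m i) \<noteq> 0" using Y.base_ge[of i] by simp
  qed simp
  show ?thesis
    unfolding moran_measure_def ln_eq
    by (rule conjI[OF coded.hausdorff_dim_measure_eq coded.packing_dim_measure_eq])
qed

end
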